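(* A simplicial set is a quasi-category (every map $\Lambda^n_j\to X$ with $0<j<n$ extends to $\Delta^n\to X$ in $\mathrm{SSet}$) if and only if it is a quasi-category in $\mathrm{Set}$, i.e. if and only if for all vertices $a,b$ of $X$ the functor $X_\bullet(a,b):\mathcal{N}ec^{op}\to\mathrm{Set}$ lifts inner horns in $\mathrm{Set}^{\mathcal{N}ec^{op}}$.
   Context: $\mathcal{N}ec$ is the category of necklaces: the objects are pairs $(T,p)$ with $p\ge0$ and $\{0,p\}\subseteq T\subseteq[p]=\{0,\dots,p\}$, and the morphisms $(T,p)\to(U,q)$ are order-preserving maps $f:[p]\to[q]$ with $f(0)=0$, $f(p)=q$ and $U\subseteq f(T)$. It is equivalent to the full subcategory of bipointed simplicial sets $\mathrm{SSet}_{*,*}$ spanned by the iterated wedges of standard simplices ($\Delta^n$ bipointed by $0$ and $n$; the wedge glues the last point of one to the first point of the next), where $T=\{0=t_0<\dots<t_k=p\}$ corresponds to $\Delta^{t_1}\vee\Delta^{t_2-t_1}\vee\dots\vee\Delta^{p-t_{k-1}}$. For a simplicial set $K$ and vertices $a,b\in K_0$, the functor $K_\bullet(a,b):\mathcal{N}ec^{op}\to\mathrm{Set}$ is $T\mapsto K_T(a,b)=\mathrm{SSet}_{*,*}(T,(K,a,b))$. Equivalently, $K_T(a,b)$ is the set of sequences $(x_1,\dots,x_k)$ with $x_i\in K_{t_i-t_{i-1}}$, $x_1$ starting at $a$, $x_k$ ending at $b$, and the last vertex of $x_i$ equal to the first vertex of $x_{i+1}$. $\Lambda^n_j$ is the union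 of all faces of $\Delta^n$ except the $j$th. A functor $Y:\mathcal{N}ec^{op}\to\mathrm{Set}$ lifts inner horns if for all $0<j<n$ every morphism $(\Lambda^n_j)_\bullet(0,n)\to Y$ in $\mathrm{Set}^{\mathcal{N}ec^{op}}$ extends along the inclusion $(\Lambda^n_j)_\bullet(0,n)\to\Delta^n_\bullet(0,n)$. Simplicial sets are identified with templicial objects in $\mathrm{Set}$ (a templicial set being a set $S$ with a strongly unital colax monoidal functor from the opposite of the category of finite intervals to $\mathrm{Set}$-enriched quivers on $S$) via $K\mapsto(K_n(a,b))_{a,b\in K_0}$, where $K_n(a,b)$ is the set of $n$-simplices with first vertex $a$ and last vertex $b$; a templicial set is a quasi-category in $\mathrm{Set}$ if all the functors $X_\bullet(a,b)$ lift inner horns. *)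

theory Defs
  imports Main "HOL-Library.FuncSet"
begin

section \<open>Categories, presheaves, natural transformations\<close>

text \<open>\<open>comp C a b c g f\<close> is the composite \<open>g \<circ> f\<close> of \<open>f : a \<rightarrow> b\<close> and \<open>g : b \<rightarrow> c\<close>.\<close>

record ('o, 'm) cat =
  ob :: "'o set"
  hom :: "'o \<Rightarrow> 'o \<Rightarrow> 'm set"
  idt :: "'o \<Rightarrow> 'm"
  comp :: "'o \<Rightarrow> 'o \<Rightarrow> 'o \<Rightarrow> 'm \<Rightarrow> 'm \<Rightarrow> 'm"

definition category :: "('o, 'm) cat \<Rightarrow> bool" where
  "category C \<longleftrightarrow>
     (\<forall>a \<in> ob C. idt C a \<in> hom C a a) \<and>
     (\<forall>a \<in> ob C. \<forall>b \<in> ob C. \<forall>f \<in> hom C a b.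
        comp C a a b f (idt C a) = f \<and> comp C a b b (idt C b) f = f) \<and>
     (\<forall>a \<in> ob C. \<forall>b \<in> ob C. \<forall>c \<in> ob C. \<forall>f \<in> hom C a b. \<forall>g \<in> hom C b c.
        comp C a b c g f \<in> hom C a c) \<and>
     (\<forall>a \<in> ob C. \<forall>b \<in> ob C. \<forall>c \<in> ob C. \<forall>d \<in> ob C.
        \<forall>f \<in> hom C a b. \<forall>g \<in> hom C b c. \<forall>h \<in> hom C c d.
        comp C a b d (comp C b c d h g) f = comp C a c d h (comp C a b c g f))"

text \<open>For \<open>f : a \<rightarrow> b\<close>, the map \<open>act F a b f\<close> goes from \<open>els F b\<close> to \<open>els F a\<close>.\<close>

record ('o, 'm, 'a) psh =
  els :: "'o \<Rightarrow> 'a set"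
  act :: "'o \<Rightarrow> 'o \<Rightarrow> 'm \<Rightarrow> 'a \<Rightarrow> 'a"

definition presheaf :: "('o, 'm) cat \<Rightarrow> ('o, 'm, 'a) psh \<Rightarrow> bool" where
  "presheaf C F \<longleftrightarrow>
     (\<forall>a \<in> ob C. \<forall>b \<in> ob C. \<forall>f \<in> hom C a b. act F a b f \<in> els F b \<rightarrow> els F a) \<and>
     (\<forall>a \<in> ob C. \<forall>x \<in> els F a. act F a a (idt C a) x = x) \<and>
     (\<forall>a \<in> ob C. \<forall>b \<in> ob C. \<forall>c \<in> ob C. \<forall>f \<in> hom C a b. \<forall>g \<in> hom C b c. \<forall>x \<in> els F c.
        act F a c (comp C a b c g f) x = act F a b f (act F b c g x))"

text \<open>Components are extensional functions, so that equality of natural transformations is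
  equality in HOL, and a transformation into a subpresheaf is literally one into the
  ambient presheaf.\<close>

definition nat_trans ::
  "('o, 'm) cat \<Rightarrow> ('o, 'm, 'a) psh \<Rightarrow> ('o, 'm, 'b) psh \<Rightarrow> ('o \<Rightarrow> 'a \<Rightarrow> 'b) set" where
  "nat_trans C F G =
     {\<phi> \<in> (\<Pi>\<^sub>E a \<in> ob C. els F a \<rightarrow>\<^sub>E els G a).
        \<forall>a \<in> ob C. \<forall>b \<in> ob C. \<forall>f \<in> hom C a b. \<forall>x \<in> els F b.
          \<phi> a (act F a b f x) = act G a b f (\<phi> b x)}"


section \<open>Simplicial sets\<close>

definition ord_maps :: "nat \<Rightarrow> nat \<Rightarrow> (nat \<Rightarrow> nat) set" where
  "ord_maps m n = {f \<in> {..m} \<rightarrow>\<^sub>E {..n}. mono_on {..m} f}"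

text \<open>The object \<open>n\<close> stands for the ordinal \<open>[n] = {0, ..., n}\<close>.\<close>

definition Simp :: "(nat, nat \<Rightarrow> nat) cat" where
  "Simp = \<lparr>ob = UNIV, hom = ord_maps, idt = (\<lambda>n. \<lambda>i\<in>{..n}. i),
           comp = (\<lambda>l m n g f. compose {..l} g f)\<rparr>"

type_synonym 'a sset = "(nat, nat \<Rightarrow> nat, 'a) psh"

abbreviation simplicial_set :: "'a sset \<Rightarrow> bool" where
  "simplicial_set \<equiv> presheaf Simp"

abbreviation sset_maps :: "'a sset \<Rightarrow> 'b sset \<Rightarrow> (nat \<Rightarrow> 'a \<Rightarrow> 'b) set" where
  "sset_maps \<equiv> nat_trans Simp"

definition std_simplex :: "nat \<Rightarrow> (nat \<Rightarrow> nat) sset" where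
  "std_simplex n = \<lparr>els = (\<lambda>m. ord_maps m n), act = (\<lambda>l m f g. compose {..l} g f)\<rparr>"

definition vert :: "nat \<Rightarrow> nat \<Rightarrow> nat" where
  "vert i = (\<lambda>k\<in>{..0}. i)"

text \<open>The \<open>i\<close>th face of the standard \<open>n\<close>-simplex consists of the maps missing \<open>i\<close>.\<close>

definition horn :: "nat \<Rightarrow> nat \<Rightarrow> (nat \<Rightarrow> nat) sset" where
  "horn n j = (std_simplex n)
     \<lparr>els := \<lambda>m. \<Union>i \<in> {..n} - {j}. {g \<in> ord_maps m n. i \<notin> g ` {..m}}\<rparr>"

definition quasi_category :: "'a sset \<Rightarrow> bool" where
  "quasi_category X \<longleftrightarrow>
     (\<forall>n j. 0 < j \<and> j < n \<longrightarrow>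
        (\<forall>\<phi> \<in> sset_maps (horn n j) X. \<exists>\<psi> \<in> sset_maps (std_simplex n) X.
           \<forall>m. \<forall>x \<in> els (horn n j) m. \<psi> m x = \<phi> m x))"


section \<open>Necklaces\<close>

definition Nec :: "(nat set \<times> nat, nat \<Rightarrow> nat) cat" where
  "Nec = \<lparr>ob = {(T, p). {0, p} \<subseteq> T \<and> T \<subseteq> {..p}},
          hom = (\<lambda>(T, p) (U, q). {f \<in> ord_maps p q. f 0 = 0 \<and> f p = q \<and> U \<subseteq> f ` T}),
          idt = (\<lambda>(T, p). \<lambda>i\<in>{..p}. i),
          comp = (\<lambda>(T, p) (U, q) (V, r) g f. compose {..p} g f)\<rparr>"

text \<open>For \<open>T = {0 = t\<^sub>0 < \<dots> < t\<^sub>k = p}\<close>, the wedge of the standard simplices of dimensions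
  \<open>t\<^sub>i - t\<^bsub>i-1\<^esub>\<close>, realised inside the standard \<open>p\<close>-simplex as the union of the simplices
  spanned by the intervals \<open>{t\<^bsub>i-1\<^esub>..t\<^sub>i}\<close>: consecutive ones meet exactly in the vertex \<open>t\<^sub>i\<close>.
  Its two base points are the vertices \<open>0\<close> and \<open>p\<close>. The degenerate choice \<open>s = t\<close> only matters
  for \<open>p = 0\<close>, where the empty wedge is the point.\<close>

definition necklace :: "nat set \<times> nat \<Rightarrow> (nat \<Rightarrow> nat) sset" where
  "necklace = (\<lambda>(T, p). (std_simplex p)
     \<lparr>els := \<lambda>m. \<Union>(s, t) \<in> {(s, t). s \<in> T \<and> t \<in> T \<and> s \<le> t \<and> T \<inter> {s<..<t} = {}}.
                  {g \<in> ord_maps m p. g ` {..m} \<subseteq> {s..t}}\<rparr>)"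

text \<open>The functor sending \<open>(T, p)\<close> to the set of bipointed maps from its necklace to \<open>(K, a, b)\<close>;
  a morphism \<open>f\<close> of necklaces acts by precomposition with the simplicial map \<open>g \<mapsto> f \<circ> g\<close>
  between necklaces.\<close>

definition nec_of ::
  "'a sset \<Rightarrow> 'a \<Rightarrow> 'a \<Rightarrow> (nat set \<times> nat, nat \<Rightarrow> nat, nat \<Rightarrow> (nat \<Rightarrow> nat) \<Rightarrow> 'a) psh" where
  "nec_of K a b =
     \<lparr>els = (\<lambda>(T, p). {\<phi> \<in> sset_maps (necklace (T, p)) K.
                          \<phi> 0 (vert 0) = a \<and> \<phi> 0 (vert p) = b}),
      act = (\<lambda>(T, p) (U, q) f \<phi>.
               \<lambda>m. \<lambda>g\<in>els (necklace (T, p)) m. \<phi> m (compose {..m} f g))\<rparr>"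

text \<open>The inclusion of the presheaf of the horn into that of the simplex is the literal inclusion
  of sets, because the horn is literally a subpresheaf of the simplex.\<close>

definition lifts_inner_horns :: "(nat set \<times> nat, nat \<Rightarrow> nat, 'b) psh \<Rightarrow> bool" where
  "lifts_inner_horns Y \<longleftrightarrow>
     (\<forall>n j. 0 < j \<and> j < n \<longrightarrow>
        (\<forall>\<phi> \<in> nat_trans Nec (nec_of (horn n j) (vert 0) (vert n)) Y.
         \<exists>\<psi> \<in> nat_trans Nec (nec_of (std_simplex n) (vert 0) (vert n)) Y.
           \<forall>T \<in> ob Nec. \<forall>x \<in> els (nec_of (horn n j) (vert 0) (vert n)) T. \<psi> T x = \<phi> T x))"

definition quasi_category_in_Set :: "'a sset \<Rightarrow> bool" where
  "quasi_category_in_Set X \<longleftrightarrow> (\<forall>a \<in> els X 0. \<forall>b \<in> els X 0. lifts_inner_horns (nec_of X a b))"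


section \<open>Well-definedness\<close>

lemma ord_maps_compose:
  "f \<in> ord_maps l m \<Longrightarrow> g \<in> ord_maps m n \<Longrightarrow> compose {..l} g f \<in> ord_maps l n"
  unfolding ord_maps_def
  by (auto simp: compose_def PiE_iff mono_on_def Pi_iff)

lemma ord_maps_id: "(\<lambda>i\<in>{..n}. i) \<in> ord_maps n n"
  by (auto simp: ord_maps_def mono_on_def)

lemma ord_maps_funcset: "f \<in> ord_maps m n \<Longrightarrow> f \<in> {..m} \<rightarrow> {..n}"
  by (auto simp: ord_maps_def)

lemma ord_maps_compose_id:
  assumes "f \<in> ord_maps m n"
  shows "compose {..m} f (\<lambda>i\<in>{..m}. i) = f" "compose {..m} (\<lambda>i\<in>{..n}. i) f = f"
  using assms by (auto simp: ord_maps_def compose_def PiE_iff extensional_def fun_eq_iff)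

lemma ord_maps_compose_assoc:
  "f \<in> ord_maps k l \<Longrightarrow> compose {..k} h (compose {..k} g f) = compose {..k} (compose {..l} h g) f"
  by (auto simp: ord_maps_def compose_def PiE_iff fun_eq_iff)

lemma category_Simp: "category Simp"
  unfolding category_def Simp_def
  by (auto simp: ord_maps_compose ord_maps_id ord_maps_compose_id ord_maps_compose_assoc)

lemma category_Nec: "category Nec"
proof -
  have comp_sub: "V \<subseteq> compose {..p} g f ` T"
    if sub: "T \<subseteq> {..p}" "U \<subseteq> f ` T" "V \<subseteq> g ` U" for T U V p and f g :: "nat \<Rightarrow> nat"
  proof
    fix v assume "v \<in> V"
    then obtain u where "u \<in> U" "v = g u" using sub(3) by blast
    then obtain t where "t \<in> T" "v = g (f t)" using sub(2) by blast
    with sub(1) show "v \<in> compose {..p} g f ` T" by (force simp: compose_def)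
  qed
  moreover have "T \<subseteq> (\<lambda>i\<in>{..p}. i) ` T" if "T \<subseteq> {..p}" for T and p :: nat
    using that by force
  ultimately show ?thesis
    unfolding category_def Nec_def
    by (auto simp: ord_maps_compose ord_maps_id ord_maps_compose_id ord_maps_compose_assoc
        compose_eq intro: subsetD[OF comp_sub])
qed

lemma simplicial_set_std_simplex: "simplicial_set (std_simplex n)"
  unfolding presheaf_def Simp_def std_simplex_def
  by (auto simp: ord_maps_compose ord_maps_compose_id ord_maps_compose_assoc)

lemma subpresheaf:
  assumes "simplicial_set K"
    and "\<And>m. A m \<subseteq> els K m"
    and "\<And>l m f x. f \<in> ord_maps l m \<Longrightarrow> x \<in> A m \<Longrightarrow> act K l m f x \<in> A l"
  shows "simplicial_set (K\<lparr>els := A\<rparr>)"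
  using assms unfolding presheaf_def by (simp add: Simp_def subset_iff)

lemma image_compose_subset: "f \<in> ord_maps l m \<Longrightarrow> compose {..l} g f ` {..l} \<subseteq> g ` {..m}"
  by (auto simp: ord_maps_def compose_def PiE_iff)

lemma simplicial_set_horn: "simplicial_set (horn n j)"
  unfolding horn_def
proof (rule subpresheaf[OF simplicial_set_std_simplex])
  fix l m f x
  assume f: "f \<in> ord_maps l m" and "x \<in> (\<Union>i\<in>{..n} - {j}. {g \<in> ord_maps m n. i \<notin> g ` {..m}})"
  then obtain i where "i \<in> {..n} - {j}" "x \<in> ord_maps m n" "i \<notin> x ` {..m}" by blast
  then show "act (std_simplex n) l m f x \<in> (\<Union>i\<in>{..n} - {j}. {g \<in> ord_maps l n. i \<notin> g ` {..l}})"
    using image_compose_subset[OF f, of x] ord_maps_compose[OF f]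
    by (auto simp: std_simplex_def subset_iff simp del: image_iff)
qed (auto simp: std_simplex_def)

lemma simplicial_set_necklace: "simplicial_set (necklace T)"
proof (cases T)
  case (Pair T p)
  show ?thesis
    unfolding necklace_def Pair prod.case
  proof (rule subpresheaf[OF simplicial_set_std_simplex])
    fix l m f x
    let ?A = "\<lambda>m. \<Union>(s, t) \<in> {(s, t). s \<in> T \<and> t \<in> T \<and> s \<le> t \<and> T \<inter> {s<..<t} = {}}.
                  {g \<in> ord_maps m p. g ` {..m} \<subseteq> {s..t}}"
    assume f: "f \<in> ord_maps l m" and "x \<in> ?A m"
    then obtain s t where st: "s \<in> T" "t \<in> T" "s \<le> t" "T \<inter> {s<..<t} = {}"
      and x: "x \<in> ord_maps m p" "x ` {..m} \<subseteq> {s..t}" by blast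
    have "compose {..l} x f ` {..l} \<subseteq> {s..t}"
      using image_compose_subset[OF f, of x] x(2) by (rule subset_trans)
    with st show "act (std_simplex p) l m f x \<in> ?A l"
      using ord_maps_compose[OF f x(1)] unfolding std_simplex_def by auto
  qed (auto simp: std_simplex_def)
qed

lemma necklace_map:
  assumes T: "(T, p) \<in> ob Nec" and f: "f \<in> hom Nec (T, p) (U, q)" and U: "(U, q) \<in> ob Nec"
    and g: "g \<in> els (necklace (T, p)) m"
  shows "compose {..m} f g \<in> els (necklace (U, q)) m"
proof -
  obtain s t where st: "s \<in> T" "t \<in> T" "s \<le> t" "T \<inter> {s<..<t} = {}"
    and gm: "g \<in> ord_maps m p" and gi: "g ` {..m} \<subseteq> {s..t}"
    using g unfolding necklace_def by auto
  have Tp: "T \<subseteq> {..p}" using T by (auto simp: Nec_def)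
  have Uq: "0 \<in> U" "q \<in> U" "U \<subseteq> {..q}" using U by (auto simp: Nec_def)
  have fm: "f \<in> ord_maps p q" and fU: "U \<subseteq> f ` T" using f by (auto simp: Nec_def)
  have mono: "f i \<le> f k" if "i \<le> k" "k \<le> p" for i k
    using fm that by (auto simp: ord_maps_def mono_on_def)
  have tp: "t \<le> p" using st Tp by auto
  have fq: "f i \<le> q" if "i \<le> p" for i using fm that by (auto simp: ord_maps_def PiE_iff)
  have gap: "u \<le> f s \<or> f t \<le> u" if u: "u \<in> U" for u
  proof -
    obtain r where r: "r \<in> T" "u = f r" using u fU by auto
    have "r \<le> s \<or> t \<le> r" using st r by force
    then show ?thesis using mono r Tp tp st by force
  qed
  have fin: "finite U" using Uq finite_subset by blast
  define s' where "s' = Max {u \<in> U. u \<le> f s}"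
  have s': "s' \<in> U" "s' \<le> f s" "\<And>u. u \<in> U \<Longrightarrow> u \<le> f s \<Longrightarrow> u \<le> s'"
  proof -
    let ?S = "{u \<in> U. u \<le> f s}"
    have "finite ?S" "0 \<in> ?S" using fin Uq by auto
    then have "Max ?S \<in> ?S" "\<And>u. u \<in> ?S \<Longrightarrow> u \<le> Max ?S"
      using Max_in[of ?S] by (blast, simp)
    then show "s' \<in> U" "s' \<le> f s" "\<And>u. u \<in> U \<Longrightarrow> u \<le> f s \<Longrightarrow> u \<le> s'"
      by (auto simp: s'_def)
  qed
  define t' where "t' = Min {u \<in> U. f t \<le> u}"
  have t': "t' \<in> U" "f t \<le> t'" "\<And>u. u \<in> U \<Longrightarrow> f t \<le> u \<Longrightarrow> t' \<le> u"
  proof -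
    let ?S = "{u \<in> U. f t \<le> u}"
    have "finite ?S" "q \<in> ?S" using fin Uq fq[OF tp] by auto
    then have "Min ?S \<in> ?S" "\<And>u. u \<in> ?S \<Longrightarrow> Min ?S \<le> u"
      using Min_in[of ?S] by (blast, simp)
    then show "t' \<in> U" "f t \<le> t'" "\<And>u. u \<in> U \<Longrightarrow> f t \<le> u \<Longrightarrow> t' \<le> u"
      by (auto simp: t'_def)
  qed
  have "s' \<le> t'" using s' t' mono[OF st(3) tp] by linarith
  moreover have "U \<inter> {s'<..<t'} = {}"
    using gap s'(3) t'(3) by (force simp: not_le[symmetric])
  moreover have "compose {..m} f g ` {..m} \<subseteq> {s'..t'}"
  proof
    fix y assume "y \<in> compose {..m} f g ` {..m}"
    then obtain i where i: "i \<le> m" "y = f (g i)" by (auto simp: compose_def)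
    then have "s \<le> g i" "g i \<le> t" using gi by auto
    then show "y \<in> {s'..t'}"
      using mono[of s "g i"] mono[of "g i" t] tp i s'(2) t'(2) by auto
  qed
  moreover have "compose {..m} f g \<in> ord_maps m q"
    using ord_maps_compose[OF gm fm] .
  ultimately show ?thesis
    using s'(1) t'(1) unfolding necklace_def by auto
qed

lemma vert_in_necklace:
  assumes "(T, p) \<in> ob Nec" "i \<in> T"
  shows "vert i \<in> els (necklace (T, p)) 0"
  using assms unfolding necklace_def vert_def Nec_def ord_maps_def
  by (force simp: mono_on_def)

lemma compose_vert: "compose {..0} f (vert i) = vert (f i)"
  by (auto simp: compose_def vert_def)

lemma presheaf_nec_of:
  assumes K: "simplicial_set K"
  shows "presheaf Nec (nec_of K a b)"
proof -
  have ext: "\<phi> m \<in> els (necklace (T, p)) m \<rightarrow>\<^sub>E els K m"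
    if "\<phi> \<in> sset_maps (necklace (T, p)) K" for \<phi> T p m
    using that by (auto simp: nat_trans_def Simp_def PiE_iff)
  have nec_act: "act (necklace (T, p)) l m f g = compose {..l} g f" for T p l m f g
    by (simp add: necklace_def std_simplex_def)
  have nec_ord: "g \<in> ord_maps m p" if "g \<in> els (necklace (T, p)) m" for g m T p
    using that by (auto simp: necklace_def)
  have closed: "compose {..l} g h \<in> els (necklace (T, p)) l"
    if "g \<in> els (necklace (T, p)) m" "h \<in> ord_maps l m" for g h l m T p
    using simplicial_set_necklace[of "(T, p)"] that
    by (simp add: presheaf_def Simp_def nec_act Pi_iff)
  have A: "act (nec_of K a b) (T, p) (U, q) f \<phi> \<in> els (nec_of K a b) (T, p)"
    if T: "(T, p) \<in> ob Nec" and U: "(U, q) \<in> ob Nec" and f: "f \<in> hom Nec (T, p) (U, q)"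
      and \<phi>: "\<phi> \<in> els (nec_of K a b) (U, q)" for T p U q f \<phi>
  proof -
    let ?\<psi> = "\<lambda>m. \<lambda>g\<in>els (necklace (T, p)) m. \<phi> m (compose {..m} f g)"
    have \<phi>': "\<phi> \<in> sset_maps (necklace (U, q)) K" "\<phi> 0 (vert 0) = a" "\<phi> 0 (vert q) = b"
      using \<phi> by (auto simp: nec_of_def)
    have nat: "\<phi> l (compose {..l} g h) = act K l m h (\<phi> m g)"
      if "h \<in> ord_maps l m" "g \<in> els (necklace (U, q)) m" for l m h g
      using \<phi>'(1) that by (simp add: nat_trans_def Simp_def nec_act)
    have f0: "f 0 = 0" "f p = q" and T0: "0 \<in> T" "p \<in> T"
      using f T by (auto simp: Nec_def)
    have "?\<psi> \<in> sset_maps (necklace (T, p)) K"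
      unfolding nat_trans_def
    proof (intro CollectI conjI ballI)
      show "?\<psi> \<in> (\<Pi>\<^sub>E m\<in>ob Simp. els (necklace (T, p)) m \<rightarrow>\<^sub>E els K m)"
        using ext[OF \<phi>'(1)] necklace_map[OF T f U] by (fastforce simp: Simp_def PiE_iff)
    next
      fix l m h g
      assume "h \<in> hom Simp l m" and g: "g \<in> els (necklace (T, p)) m"
      then have h: "h \<in> ord_maps l m" by (simp add: Simp_def)
      have "?\<psi> l (compose {..l} g h) = \<phi> l (compose {..l} (compose {..m} f g) h)"
        using closed[OF g h] ord_maps_compose_assoc[OF h, of f g] by (simp only: restrict_apply if_True)
      also have "\<dots> = act K l m h (?\<psi> m g)"
        using nat[OF h necklace_map[OF T f U g]] g by simp
      finally show "?\<psi> l (act (necklace (T, p)) l m h g) = act K l m h (?\<psi> m g)"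
        by (simp add: nec_act)
    qed
    moreover have "?\<psi> 0 (vert 0) = a" "?\<psi> 0 (vert p) = b"
      using vert_in_necklace[OF T] T0 \<phi>'(2,3) f0 compose_vert[of f] by auto
    ultimately show ?thesis by (simp add: nec_of_def)
  qed
  have B: "act (nec_of K a b) (T, p) (T, p) (idt Nec (T, p)) \<phi> = \<phi>"
    if "\<phi> \<in> els (nec_of K a b) (T, p)" for T p \<phi>
  proof
    fix m
    have "\<phi> m \<in> extensional (els (necklace (T, p)) m)"
      using that ext[of \<phi> T p m] by (auto simp: nec_of_def PiE_iff)
    then show "act (nec_of K a b) (T, p) (T, p) (idt Nec (T, p)) \<phi> m = \<phi> m"
      by (auto simp: nec_of_def Nec_def fun_eq_iff extensional_def
          ord_maps_compose_id(2)[OF nec_ord])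
  qed
  have C: "act (nec_of K a b) (T, p) (V, r) (comp Nec (T, p) (U, q) (V, r) g f) \<phi> =
      act (nec_of K a b) (T, p) (U, q) f (act (nec_of K a b) (U, q) (V, r) g \<phi>)"
    if T: "(T, p) \<in> ob Nec" and U: "(U, q) \<in> ob Nec" and f: "f \<in> hom Nec (T, p) (U, q)"
    for T p U q V r f g \<phi>
  proof (rule HOL.ext, rule HOL.ext)
    fix m h
    show "act (nec_of K a b) (T, p) (V, r) (comp Nec (T, p) (U, q) (V, r) g f) \<phi> m h =
      act (nec_of K a b) (T, p) (U, q) f (act (nec_of K a b) (U, q) (V, r) g \<phi>) m h"
    proof (cases "h \<in> els (necklace (T, p)) m")
      case True
      then have h: "h \<in> {..m} \<rightarrow> {..p}" using nec_ord ord_maps_funcset by blast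
      have "compose {..m} (compose {..p} g f) h = compose {..m} g (compose {..m} f h)"
        using h by (auto simp: compose_def fun_eq_iff)
      then show ?thesis
        using True necklace_map[OF T f U True] by (simp add: nec_of_def Nec_def)
    qed (simp add: nec_of_def Nec_def)
  qed
  show ?thesis
    unfolding presheaf_def using A B C by auto
qed

end

theory Submission
  imports Defs
begin

text \<open>A necklace map into a simplex or a horn is given by an order-preserving map \<open>c\<close> of ordinals, and
  every simplex of an inner horn has the form \<open>c \<circ> h\<close> for such a bipointed map \<open>c\<close> into the horn and a
  simplex \<open>h\<close> of the necklace; this also covers the two faces opposite the base points, preceded or
  followed by a further bead. Under a natural transformation \<open>\<phi>\<close> out of the presheaf of the
  horn, the value \<open>\<phi> c h\<close> turns out to depend only on \<open>c \<circ> h\<close>: when this simplex is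
  not constant at a base point, both representations are compared through a common refinement, and
  otherwise the value is a degenerate base point. Hence \<open>\<phi>\<close> comes from a simplicial map on
  the horn, and a filler of that map extends \<open>\<phi>\<close>. Conversely, a simplicial map on the horn induces
  such a \<open>\<phi>\<close>, and an extension of \<open>\<phi>\<close> evaluated at the identity of the simplex is a filler.\<close>

section \<open>Order-preserving maps, horns and necklaces\<close>

lemma ord_mapsI:
  assumes "\<And>i. i \<le> m \<Longrightarrow> f i \<le> n" "\<And>i k. i \<le> k \<Longrightarrow> k \<le> m \<Longrightarrow> f i \<le> f k"
    "f \<in> extensional {..m}"
  shows "f \<in> ord_maps m n"
  using assms by (auto simp: ord_maps_def mono_on_def PiE_iff)

lemma ord_maps_le: "f \<in> ord_maps m n \<Longrightarrow> i \<le> m \<Longrightarrow> f i \<le> n"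
  by (auto simp: ord_maps_def PiE_iff)

lemma ord_maps_mono: "f \<in> ord_maps m n \<Longrightarrow> i \<le> k \<Longrightarrow> k \<le> m \<Longrightarrow> f i \<le> f k"
  by (auto simp: ord_maps_def mono_on_def)

lemma ord_maps_extensional: "f \<in> ord_maps m n \<Longrightarrow> f \<in> extensional {..m}"
  by (auto simp: ord_maps_def PiE_iff)

lemma ord_maps_eqI:
  assumes "f \<in> ord_maps m n" "g \<in> ord_maps m n" "\<And>i. i \<le> m \<Longrightarrow> f i = g i"
  shows "f = g"
  using assms by (intro extensionalityI[of f "{..m}"]) (auto intro: ord_maps_extensional)

lemma compose_extensional_atMost [simp]: "compose {..m::nat} f g \<in> extensional {..m}"
  by (simp add: compose_def)

lemma compose_apply [simp]: "i \<le> m \<Longrightarrow> compose {..m::nat} f g i = f (g i)"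
  by (simp add: compose_def)

lemma vert_ord_maps: "i \<le> n \<Longrightarrow> vert i \<in> ord_maps 0 n"
  by (rule ord_mapsI) (auto simp: vert_def)

lemma const_ord_maps: "i \<le> n \<Longrightarrow> (\<lambda>k\<in>{..m}. i) \<in> ord_maps m n"
  by (rule ord_mapsI) auto

lemma els_horn_iff:
  "g \<in> els (horn n j) m \<longleftrightarrow> g \<in> ord_maps m n \<and> (\<exists>i\<le>n. i \<noteq> j \<and> (\<forall>k\<le>m. g k \<noteq> i))"
  by (simp add: horn_def image_iff Bex_def Ball_def) (auto simp: eq_commute)

lemma act_horn: "act (horn n j) l m f g = compose {..l} g f"
  by (simp add: horn_def std_simplex_def)

lemma els_std_simplex: "els (std_simplex n) m = ord_maps m n"
  by (simp add: std_simplex_def)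

lemma act_std_simplex: "act (std_simplex n) l m f g = compose {..l} g f"
  by (simp add: std_simplex_def)

lemma act_necklace: "act (necklace (T, p)) l m f g = compose {..l} g f"
  by (simp add: necklace_def std_simplex_def)

lemma ob_Nec_iff: "(T, p) \<in> ob Nec \<longleftrightarrow> 0 \<in> T \<and> p \<in> T \<and> T \<subseteq> {..p}"
  by (auto simp: Nec_def)

lemma hom_Nec_iff:
  "f \<in> hom Nec (T, p) (U, q) \<longleftrightarrow> f \<in> ord_maps p q \<and> f 0 = 0 \<and> f p = q \<and> U \<subseteq> f ` T"
  by (simp add: Nec_def)

text \<open>A monotone \<open>g\<close> has its image between \<open>g 0\<close> and
  \<open>g m\<close>, so it stays in one bead exactly when no joint separates these two values. This
  replaces the union over beads by a condition on two numbers.\<close>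

lemma els_necklace_iff:
  assumes T: "(T, p) \<in> ob Nec"
  shows "g \<in> els (necklace (T, p)) m \<longleftrightarrow> g \<in> ord_maps m p \<and> T \<inter> {g 0<..<g m} = {}"
    (is "?l \<longleftrightarrow> ?r")
proof
  assume ?l
  then obtain s t where "g \<in> ord_maps m p" "T \<inter> {s<..<t} = {}" "g ` {..m} \<subseteq> {s..t}"
    unfolding necklace_def by auto
  moreover from this have "s \<le> g 0" "g m \<le> t" by auto
  ultimately show ?r by fastforce
next
  assume r: ?r
  then have g: "g \<in> ord_maps m p" and gap: "\<And>u. u \<in> T \<Longrightarrow> u \<le> g 0 \<or> g m \<le> u"
    by force+
  have T': "0 \<in> T" "p \<in> T" "finite T" using T finite_subset by (auto simp: ob_Nec_iff)
  have g0m: "g 0 \<le> g m" "g m \<le> p" using g by (auto intro: ord_maps_mono ord_maps_le)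
  \<comment> \<open>The candidate bead runs from the last joint at or before \<open>g 0\<close> to
    the first joint at or after \<open>g m\<close>.\<close>
  define s where "s = Max {u \<in> T. u \<le> g 0}"
  define t where "t = Min {u \<in> T. g m \<le> u}"
  have fin: "finite {u \<in> T. u \<le> g 0}" "finite {u \<in> T. g m \<le> u}"
    "{u \<in> T. u \<le> g 0} \<noteq> {}" "{u \<in> T. g m \<le> u} \<noteq> {}" using T' g0m by auto
  have s: "s \<in> T" "s \<le> g 0" using Max_in[OF fin(1,3)] by (auto simp: s_def)
  have t: "t \<in> T" "g m \<le> t" using Min_in[OF fin(2,4)] by (auto simp: t_def)
  have "T \<inter> {s<..<t} = {}"
  proof -
    have "u \<le> s \<or> t \<le> u" if "u \<in> T" for u
      using gap[OF that] that Max_ge[OF fin(1), of u] Min_le[OF fin(2), of u]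
      by (auto simp: s_def t_def)
    then show ?thesis by force
  qed
  moreover have "g ` {..m} \<subseteq> {s..t}"
    using ord_maps_mono[OF g, of 0] ord_maps_mono[OF g, of _ m] s t by force
  moreover have "s \<le> t" using s t g0m by simp
  ultimately show ?l using s t g unfolding necklace_def by auto
qed

lemma necklace_ord_maps: "g \<in> els (necklace (T, p)) m \<Longrightarrow> g \<in> ord_maps m p"
  by (auto simp: necklace_def)

lemma necklace_compose:
  assumes "g \<in> els (necklace (T, p)) m" "f \<in> ord_maps l m"
  shows "compose {..l} g f \<in> els (necklace (T, p)) l"
  using simplicial_set_necklace[of "(T, p)"] assms
  by (simp add: presheaf_def Simp_def act_necklace Pi_iff)


section \<open>Necklace maps into a simplex\<close>

text \<open>The simplicial map out of a necklace induced by a map \<open>c\<close> of vertices; it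
  is extensional, like the components in \<open>nat_trans\<close>, so that such maps can be compared
  by equality.\<close>

definition push :: "nat set \<times> nat \<Rightarrow> (nat \<Rightarrow> nat) \<Rightarrow> nat \<Rightarrow> (nat \<Rightarrow> nat) \<Rightarrow> nat \<Rightarrow> nat" where
  "push T c = (\<lambda>m. \<lambda>h\<in>els (necklace T) m. compose {..m} c h)"

lemma sset_mapsI:
  assumes "\<And>m x. x \<in> els K m \<Longrightarrow> \<phi> m x \<in> els L m"
    and "\<And>m. \<phi> m \<in> extensional (els K m)"
    and "\<And>l m f x. f \<in> ord_maps l m \<Longrightarrow> x \<in> els K m \<Longrightarrow>
      \<phi> l (act K l m f x) = act L l m f (\<phi> m x)"
  shows "\<phi> \<in> sset_maps K L"
  using assms by (auto simp: nat_trans_def Simp_def PiE_iff)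

lemma sset_maps_els: "\<phi> \<in> sset_maps K L \<Longrightarrow> x \<in> els K m \<Longrightarrow> \<phi> m x \<in> els L m"
  by (auto simp: nat_trans_def Simp_def PiE_iff)

lemma sset_maps_extensional: "\<phi> \<in> sset_maps K L \<Longrightarrow> \<phi> m \<in> extensional (els K m)"
  by (auto simp: nat_trans_def Simp_def PiE_iff)

lemma sset_maps_act:
  "\<phi> \<in> sset_maps K L \<Longrightarrow> f \<in> ord_maps l m \<Longrightarrow> x \<in> els K m \<Longrightarrow>
    \<phi> l (act K l m f x) = act L l m f (\<phi> m x)"
  by (auto simp: nat_trans_def Simp_def)

lemma els_nec_of_iff:
  "\<phi> \<in> els (nec_of K a b) (T, p) \<longleftrightarrow>
    \<phi> \<in> sset_maps (necklace (T, p)) K \<and> \<phi> 0 (vert 0) = a \<and> \<phi> 0 (vert p) = b"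
  by (simp add: nec_of_def)

lemma act_nec_of:
  "act (nec_of K a b) (T, p) (U, q) f \<phi> =
    (\<lambda>m. \<lambda>g\<in>els (necklace (T, p)) m. \<phi> m (compose {..m} f g))"
  by (simp add: nec_of_def)

lemma vert_inject [simp]: "vert i = vert k \<longleftrightarrow> i = k"
  by (auto simp: vert_def fun_eq_iff split: if_splits)

text \<open>Naturality is associativity of composition, as \<open>K\<close> acts by precomposition.
  This form serves the simplex and the horn alike: only the images of the beads remain to be
  checked.\<close>

lemma push_in_nec_of:
  assumes T: "(T, p) \<in> ob Nec" and c: "c 0 = 0" "c p = n"
    and K: "\<And>l m f x. act K l m f x = compose {..l} x f"
    and els: "\<And>m h. h \<in> els (necklace (T, p)) m \<Longrightarrow> compose {..m} c h \<in> els K m"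
  shows "push (T, p) c \<in> els (nec_of K (vert 0) (vert n)) (T, p)"
  unfolding els_nec_of_iff
proof (intro conjI sset_mapsI)
  fix l m f h assume f: "f \<in> ord_maps l m" and h: "h \<in> els (necklace (T, p)) m"
  then show "push (T, p) c l (act (necklace (T, p)) l m f h) = act K l m f (push (T, p) c m h)"
    using necklace_compose[OF h f] ord_maps_compose_assoc[OF f, of c h]
    by (simp add: push_def act_necklace K)
next
  have "vert 0 \<in> els (necklace (T, p)) 0" "vert p \<in> els (necklace (T, p)) 0"
    using T by (auto intro!: vert_in_necklace simp: ob_Nec_iff)
  then show "push (T, p) c 0 (vert 0) = vert 0" "push (T, p) c 0 (vert p) = vert n"
    using compose_vert[of c] c by (simp_all add: push_def)
qed (use els in \<open>auto simp: push_def\<close>)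

lemma vert_in_necklace': "(T, p) \<in> ob Nec \<Longrightarrow> i \<le> p \<Longrightarrow> vert i \<in> els (necklace (T, p)) 0"
  by (simp add: els_necklace_iff vert_ord_maps)

text \<open>A simplex of a standard simplex is determined by its vertices, so \<chi> is determined
  by its values \<open>c\<close> on vertices; \<open>c\<close> is monotone because the edge from
  \<open>i\<close> to \<open>Suc i\<close> always lies inside a bead.\<close>

lemma sset_maps_necklace_std_simplex:
  assumes T: "(T, p) \<in> ob Nec" and \<chi>: "\<chi> \<in> sset_maps (necklace (T, p)) (std_simplex n)"
  obtains c where "c \<in> ord_maps p n" "\<chi> = push (T, p) c"
proof
  define c where "c = (\<lambda>i\<in>{..p}. \<chi> 0 (vert i) 0)"
  have val: "\<chi> m h k = c (h k)" if h: "h \<in> els (necklace (T, p)) m" and k: "k \<le> m" for m h k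
  proof -
    \<comment> \<open>Naturality along the inclusion of the vertex \<open>k\<close> reads off the
      corresponding vertex of \<open>\<chi> m h\<close>.\<close>
    have "\<chi> 0 (compose {..0} h (vert k)) = compose {..0} (\<chi> m h) (vert k)"
      using sset_maps_act[OF \<chi> vert_ord_maps[OF k] h] by (simp add: act_necklace act_std_simplex)
    then have "\<chi> 0 (vert (h k)) = vert (\<chi> m h k)" by (simp only: compose_vert)
    moreover have "h k \<le> p" using h k by (meson necklace_ord_maps ord_maps_le)
    ultimately show ?thesis by (simp add: c_def vert_def)
  qed
  have in_ord: "\<chi> m h \<in> ord_maps m n" if "h \<in> els (necklace (T, p)) m" for m h
    using sset_maps_els[OF \<chi> that] by (simp add: els_std_simplex)
  have step: "c i \<le> c (Suc i)" if i: "Suc i \<le> p" for i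
  proof -
    let ?e = "\<lambda>k\<in>{..1}. i + k"
    have e: "?e \<in> els (necklace (T, p)) 1"
      using i by (auto simp: els_necklace_iff[OF T] intro!: ord_mapsI)
    show ?thesis
      using ord_maps_mono[OF in_ord[OF e], of 0 1] val[OF e, of 0] val[OF e, of 1] by simp
  qed
  have mono: "c i \<le> c k" if "i \<le> k" "k \<le> p" for i k
    using that by (induction rule: dec_induct) (auto intro: order_trans step)
  show "c \<in> ord_maps p n"
  proof (rule ord_mapsI)
    fix i assume i: "i \<le> p"
    show "c i \<le> n"
      using ord_maps_le[OF in_ord[OF vert_in_necklace'[OF T i]], of 0] i by (simp add: c_def)
  qed (use mono in \<open>auto simp: c_def\<close>)
  show "\<chi> = push (T, p) c"
  proof (intro ext)
    fix m h k
    show "\<chi> m h k = push (T, p) c m h k"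
    proof (cases "h \<in> els (necklace (T, p)) m")
      case True
      then show ?thesis
        using val[OF True, of k] ord_maps_extensional[OF in_ord[OF True]]
        by (cases "k \<le> m") (auto simp: push_def compose_def extensional_def)
    next
      case False
      then show ?thesis
        using sset_maps_extensional[OF \<chi>, of m] by (simp add: push_def extensional_def)
    qed
  qed
qed

lemma sset_maps_horn_std_simplex:
  "\<chi> \<in> sset_maps K (horn n j) \<Longrightarrow> \<chi> \<in> sset_maps K (std_simplex n)"
  by (rule sset_mapsI)
    (auto dest: sset_maps_els sset_maps_extensional sset_maps_act
      simp: els_horn_iff act_horn act_std_simplex els_std_simplex)

lemma nec_of_horn_cases:
  assumes T: "(T, p) \<in> ob Nec"
    and \<chi>: "\<chi> \<in> els (nec_of (horn n j) (vert 0) (vert n)) (T, p)"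
  obtains c where "c \<in> ord_maps p n" "c 0 = 0" "c p = n" "\<chi> = push (T, p) c"
    "\<And>m h. h \<in> els (necklace (T, p)) m \<Longrightarrow> compose {..m} c h \<in> els (horn n j) m"
proof -
  have \<chi>': "\<chi> \<in> sset_maps (necklace (T, p)) (horn n j)"
    and v: "\<chi> 0 (vert 0) = vert 0" "\<chi> 0 (vert p) = vert n"
    using \<chi> by (auto simp: els_nec_of_iff)
  obtain c where c: "c \<in> ord_maps p n" "\<chi> = push (T, p) c"
    using sset_maps_necklace_std_simplex[OF T sset_maps_horn_std_simplex[OF \<chi>']] .
  show thesis
  proof (rule that[OF c(1) _ _ c(2)])
    show "c 0 = 0" "c p = n"
      using v vert_in_necklace'[OF T, of 0] vert_in_necklace'[OF T, of p] compose_vert[of c]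
      by (simp_all add: c(2) push_def)
    show "compose {..m} c h \<in> els (horn n j) m" if "h \<in> els (necklace (T, p)) m" for m h
      using sset_maps_els[OF \<chi>' that] that by (simp add: c(2) push_def)
  qed
qed

text \<open>The functor action becomes composition of ordinal maps, which reduces naturality to
  equations between maps of vertices.\<close>

lemma act_push:
  assumes "(T, p) \<in> ob Nec" "f \<in> hom Nec (T, p) (U, q)" "(U, q) \<in> ob Nec"
  shows "act (nec_of K a b) (T, p) (U, q) f (push (U, q) c) = push (T, p) (compose {..p} c f)"
proof (intro ext)
  fix m h k
  show "act (nec_of K a b) (T, p) (U, q) f (push (U, q) c) m h k =
    push (T, p) (compose {..p} c f) m h k"
  proof (cases "h \<in> els (necklace (T, p)) m")
    case True
    then have "h k \<le> p" if "k \<le> m" using that by (meson necklace_ord_maps ord_maps_le)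
    then show ?thesis
      using True necklace_map[OF assms True] by (auto simp: act_nec_of push_def compose_def)
  qed (simp add: act_nec_of push_def)
qed

section \<open>Presenting the simplices of a horn by necklaces\<close>

text \<open>For \<open>h : [m] \<rightarrow> [p]\<close>, the map \<open>plug m p h\<close> goes from \<open>\<Delta>\<^bsup>h 0\<^esup> \<or> \<Delta>\<^bsup>m\<^esup> \<or> \<Delta>\<^bsup>p - h m\<^esup>\<close> to
  \<open>\<Delta>\<^bsup>p\<^esup>\<close>; it is \<open>h\<close> on the middle bead and an inclusion on the outer ones.\<close>

definition plug_dim :: "nat \<Rightarrow> nat \<Rightarrow> (nat \<Rightarrow> nat) \<Rightarrow> nat" where
  "plug_dim m p h = h 0 + m + (p - h m)"

definition plug :: "nat \<Rightarrow> nat \<Rightarrow> (nat \<Rightarrow> nat) \<Rightarrow> nat \<Rightarrow> nat" where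
  "plug m p h = (\<lambda>i\<in>{..plug_dim m p h}.
     if i \<le> h 0 then i else if i \<le> h 0 + m then h (i - h 0) else i - (h 0 + m) + h m)"

definition middle :: "nat \<Rightarrow> (nat \<Rightarrow> nat) \<Rightarrow> nat \<Rightarrow> nat" where
  "middle m h = (\<lambda>i\<in>{..m}. h 0 + i)"

text \<open>Joints may coincide: an outer bead is a point when \<open>h 0 = 0\<close> or
  \<open>h m = p\<close>, the middle one when \<open>m = 0\<close>.\<close>

definition three_beads :: "nat \<Rightarrow> nat \<Rightarrow> (nat \<Rightarrow> nat) \<Rightarrow> nat set \<times> nat" where
  "three_beads m p h = ({0, h 0, h 0 + m, plug_dim m p h}, plug_dim m p h)"

lemma plug_ord_maps:
  assumes h: "h \<in> ord_maps m p"
  shows "plug m p h \<in> ord_maps (plug_dim m p h) p"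
proof (rule ord_mapsI)
  note le = ord_maps_le[OF h] and mono = ord_maps_mono[OF h]
  fix i assume i: "i \<le> plug_dim m p h"
  show "plug m p h i \<le> p"
    using i le[of 0] le[of m] le[of "i - h 0"] by (auto simp: plug_def plug_dim_def)
next
  note le = ord_maps_le[OF h] and mono = ord_maps_mono[OF h]
  fix i k assume ik: "i \<le> k" "k \<le> plug_dim m p h"
  then have i: "i \<le> plug_dim m p h" by simp
  have bound: "h 0 \<le> h x" "h x \<le> h m" if "x \<le> m" for x using mono that by auto
  consider "k \<le> h 0" | "h 0 < k" "k \<le> h 0 + m" | "h 0 + m < k" by linarith
  then show "plug m p h i \<le> plug m p h k"
  proof cases
    case 2
    then show ?thesis
      using ik i order_trans[OF _ bound(1)[of "k - h 0"], of i] mono[of "i - h 0" "k - h 0"]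
      by (auto simp: plug_def)
  next
    case 3
    have "h (i - h 0) \<le> h m" if "i \<le> h 0 + m" using bound(2)[of "i - h 0"] that by simp
    then show ?thesis
      using 3 ik i bound(1)[of m] by (auto simp: plug_def)
  qed (use ik i in \<open>auto simp: plug_def\<close>)
qed (simp add: plug_def)

lemma plug_right: "d \<le> p - h m \<Longrightarrow> plug m p h (h 0 + m + d) = h m + d"
  \<comment> \<open>At \<open>d = 0\<close> the last branch of \<open>plug\<close> is not taken: the
    value \<open>h m\<close> comes from the middle branch, or from the first one if
    \<open>m = 0\<close>.\<close>
  by (cases d; cases m) (auto simp: plug_def plug_dim_def)

lemma plug_ends:
  assumes h: "h \<in> ord_maps m p"
  shows "plug m p h 0 = 0" "plug m p h (plug_dim m p h) = p"
  using ord_maps_le[OF h, of m] plug_right[of "p - h m" p h m]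
  by (simp_all add: plug_def plug_dim_def)

lemma middle_ord_maps: "middle m h \<in> ord_maps m (plug_dim m p h)"
  by (rule ord_mapsI) (auto simp: middle_def plug_dim_def)

lemma plug_middle:
  assumes h: "h \<in> ord_maps m p"
  shows "compose {..m} (plug m p h) (middle m h) = h"
proof (rule ord_maps_eqI[OF ord_maps_compose[OF middle_ord_maps plug_ord_maps[OF h]] h])
  fix i assume "i \<le> m"
  then show "compose {..m} (plug m p h) (middle m h) i = h i"
    by (auto simp: middle_def plug_def plug_dim_def)
qed

lemma three_beads_ob: "three_beads m p h \<in> ob Nec"
  by (auto simp: three_beads_def ob_Nec_iff plug_dim_def)

lemma middle_in_three_beads: "middle m h \<in> els (necklace (three_beads m p h)) m"
  using three_beads_ob[of m p h] middle_ord_maps[of m h p] unfolding three_beads_def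
  by (auto simp: els_necklace_iff middle_def plug_dim_def)

text \<open>Each bead lands in a face of the horn: the first stays at or below \<open>g 0\<close>
  and misses \<open>n\<close>, the last stays at or above \<open>g m\<close> and misses
  \<open>0\<close>, and the middle one traces \<open>g\<close>, which misses some
  \<open>i \<noteq> j\<close>. The faces opposite \<open>0\<close> and \<open>n\<close> belong to
  the horn because it is inner.\<close>

lemma push_plug:
  assumes g: "g \<in> els (horn n j) m" "g 0 < n" "0 < g m" and j: "0 < j" "j < n"
  shows "push (three_beads m n g) (plug m n g)
    \<in> els (nec_of (horn n j) (vert 0) (vert n)) (three_beads m n g)"
proof -
  let ?q = "plug_dim m n g"
  let ?T = "{0, g 0, g 0 + m, ?q}"
  have T: "(?T, ?q) \<in> ob Nec" using three_beads_ob by (simp add: three_beads_def)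
  obtain i where gm: "g \<in> ord_maps m n" and i: "i \<le> n" "i \<noteq> j" "\<And>k. k \<le> m \<Longrightarrow> g k \<noteq> i"
    using g(1) by (auto simp: els_horn_iff)
  have "compose {..l} (plug m n g) h \<in> els (horn n j) l" if h: "h \<in> els (necklace (?T, ?q)) l" for l h
  proof -
    have ho: "h \<in> ord_maps l ?q" and gap: "?T \<inter> {h 0<..<h l} = {}"
      using h by (auto simp: els_necklace_iff[OF T])
    have hk: "h 0 \<le> h k" "h k \<le> h l" "h k \<le> ?q" if "k \<le> l" for k
      using ord_maps_mono[OF ho] ord_maps_le[OF ho] that by auto
    have "\<exists>i\<le>n. i \<noteq> j \<and> (\<forall>k\<le>l. plug m n g (h k) \<noteq> i)"
    proof -
      \<comment> \<open>No joint separates \<open>h 0\<close> from \<open>h l\<close>, so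
        \<open>h\<close> lies in one of the three beads.\<close>
      consider "h l \<le> g 0" | "g 0 + m \<le> h 0" | "g 0 \<le> h 0" "h l \<le> g 0 + m"
        using gap by force
      then show ?thesis
      proof cases
        case 1
        then show ?thesis using hk g(2) j by (intro exI[of _ n]) (force simp: plug_def)
      next
        case 2
        have "plug m n g (h k) \<noteq> 0" if "k \<le> l" for k
        proof -
          have "h k \<ge> g 0 + m" "h k \<le> ?q" using 2 hk[OF that] by auto
          then show ?thesis using g(3) by (cases m) (auto simp: plug_def)
        qed
        then show ?thesis using j by (intro exI[of _ 0]) auto
      next
        case 3
        have "plug m n g (h k) \<noteq> i" if "k \<le> l" for k
        proof -
          have k: "h k \<ge> g 0" "h k \<le> g 0 + m" "h k \<le> ?q" using 3 hk[OF that] by auto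
          then have "plug m n g (h k) = g (h k - g 0)" by (auto simp: plug_def)
          then show ?thesis using k i(3)[of "h k - g 0"] by simp
        qed
        then show ?thesis using i by blast
      qed
    qed
    moreover have "compose {..l} (plug m n g) h \<in> ord_maps l n"
      using ord_maps_compose[OF ho plug_ord_maps[OF gm]] .
    ultimately show ?thesis by (auto simp: els_horn_iff)
  qed
  then show ?thesis
    unfolding three_beads_def
    by (intro push_in_nec_of[OF T]) (auto simp: plug_ends[OF gm] act_horn)
qed

text \<open>A constant simplex at \<open>0\<close> or \<open>n\<close> needs the separate necklace \<open>\<Delta>\<^bsup>1\<^esup> \<or> \<Delta>\<^bsup>n-1\<^esup>\<close>: for it,
  \<open>three_beads\<close> would contain the bead \<open>\<Delta>\<^bsup>n\<^esup>\<close>, which is not in the horn.\<close>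

lemma horn_simplex_presentation:
  assumes g: "g \<in> els (horn n j) m" and j: "0 < j" "j < n"
  obtains T p c h where "(T, p) \<in> ob Nec" "c \<in> ord_maps p n" "c 0 = 0" "c p = n"
    "push (T, p) c \<in> els (nec_of (horn n j) (vert 0) (vert n)) (T, p)"
    "h \<in> els (necklace (T, p)) m" "compose {..m} c h = g"
proof (cases "g 0 < n \<and> 0 < g m")
  case True
  have gm: "g \<in> ord_maps m n" using g by (simp add: els_horn_iff)
  show thesis
    using that[of "{0, g 0, g 0 + m, plug_dim m n g}" "plug_dim m n g" "plug m n g" "middle m g"]
      three_beads_ob[of m n g] plug_ord_maps[OF gm] plug_ends[OF gm] plug_middle[OF gm]
      push_plug[OF g _ _ j] middle_in_three_beads[of m g n] True
    by (simp add: three_beads_def)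
next
  case False
  let ?c = "\<lambda>i\<in>{..n}. i"
  have gm: "g \<in> ord_maps m n" using g by (simp add: els_horn_iff)
  have T: "({0, 1, n}, n) \<in> ob Nec" using j by (auto simp: ob_Nec_iff)
  have const: "g 0 = g m"
    using False ord_maps_mono[OF gm, of 0 m] ord_maps_le[OF gm, of m] by auto
  have "compose {..l} ?c h \<in> els (horn n j) l" if h: "h \<in> els (necklace ({0, 1, n}, n)) l" for l h
  proof -
    have ho: "h \<in> ord_maps l n" and gap: "h l \<le> 1 \<or> 1 \<le> h 0"
      using iffD1[OF els_necklace_iff[OF T] h] by auto
    have hk: "h 0 \<le> h k" "h k \<le> h l" if "k \<le> l" for k
      using ord_maps_mono[OF ho] that by auto
    \<comment> \<open>The bead on \<open>0, 1\<close> misses \<open>n\<close>, as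
      \<open>1 < n\<close>, and the bead on \<open>1..n\<close> misses \<open>0\<close>; so the
      identity of \<open>[n]\<close> defines a necklace in the horn.\<close>
    have "\<exists>i\<le>n. i \<noteq> j \<and> (\<forall>k\<le>l. h k \<noteq> i)"
      using gap
    proof
      assume "h l \<le> 1"
      then show ?thesis using hk j by (intro exI[of _ n]) force
    next
      assume "1 \<le> h 0"
      then show ?thesis using hk j by (intro exI[of _ 0]) force
    qed
    then show ?thesis using ho by (simp add: els_horn_iff ord_maps_compose_id)
  qed
  then have "push ({0, 1, n}, n) ?c \<in> els (nec_of (horn n j) (vert 0) (vert n)) ({0, 1, n}, n)"
    by (intro push_in_nec_of[OF T]) (auto simp: act_horn)
  moreover have "g \<in> els (necklace ({0, 1, n}, n)) m"
    using gm const by (intro iffD2[OF els_necklace_iff[OF T]]) simp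
  ultimately show thesis
    using that[OF T ord_maps_id, of g] ord_maps_compose_id(2)[OF gm] by simp
qed

section \<open>Transformations out of the presheaf of a horn\<close>

locale horn_transformation =
  fixes X :: "'a sset" and n j :: nat and a b :: 'a and \<phi>
  assumes X: "simplicial_set X" and j: "0 < j" "j < n"
    and \<phi>: "\<phi> \<in> nat_trans Nec (nec_of (horn n j) (vert 0) (vert n)) (nec_of X a b)"
begin

abbreviation H :: "(nat set \<times> nat, nat \<Rightarrow> nat, nat \<Rightarrow> (nat \<Rightarrow> nat) \<Rightarrow> nat \<Rightarrow> nat) psh" where
  "H \<equiv> nec_of (horn n j) (vert 0) (vert n)"

lemma \<phi>_els:
  assumes "(T, p) \<in> ob Nec" "\<chi> \<in> els H (T, p)"
  shows "\<phi> (T, p) \<chi> \<in> sset_maps (necklace (T, p)) X"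
    "\<phi> (T, p) \<chi> 0 (vert 0) = a" "\<phi> (T, p) \<chi> 0 (vert p) = b"
proof -
  have "\<phi> (T, p) \<chi> \<in> els (nec_of X a b) (T, p)"
    using \<phi> assms by (auto simp: nat_trans_def PiE_iff)
  then show "\<phi> (T, p) \<chi> \<in> sset_maps (necklace (T, p)) X"
    "\<phi> (T, p) \<chi> 0 (vert 0) = a" "\<phi> (T, p) \<chi> 0 (vert p) = b" by (auto simp: els_nec_of_iff)
qed

text \<open>Naturality of \<phi> in its working form: precomposing the vertex map with
  \<open>f\<close> amounts to moving the simplex \<open>h\<close> along \<open>f\<close>.\<close>

lemma \<phi>_push_compose:
  assumes f: "(T, p) \<in> ob Nec" "f \<in> hom Nec (T, p) (U, q)" "(U, q) \<in> ob Nec"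
    and c: "push (U, q) c \<in> els H (U, q)" and h: "h \<in> els (necklace (T, p)) m"
  shows "\<phi> (T, p) (push (T, p) (compose {..p} c f)) m h
    = \<phi> (U, q) (push (U, q) c) m (compose {..m} f h)"
proof -
  have "\<phi> (T, p) (act H (T, p) (U, q) f (push (U, q) c))
      = act (nec_of X a b) (T, p) (U, q) f (\<phi> (U, q) (push (U, q) c))"
    using \<phi> f c unfolding nat_trans_def by blast
  then show ?thesis
    unfolding act_push[OF f] using h by (simp add: act_nec_of)
qed

text \<open>Refining \<open>T\<close> to \<open>B\<close>, which isolates \<open>h\<close> as a bead between spines, one can map both to the
  given necklace and to \<open>three_beads\<close>; hence the value at \<open>h\<close> only depends on \<open>c \<circ> h\<close>.\<close>

lemma \<phi>_push_nonconstant: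
  assumes T: "(T, p) \<in> ob Nec" and c: "c \<in> ord_maps p n" "c 0 = 0" "c p = n"
    and \<chi>: "push (T, p) c \<in> els H (T, p)" and h: "h \<in> els (necklace (T, p)) m"
    and g: "g = compose {..m} c h" "g \<in> els (horn n j) m" "g 0 < n" "0 < g m"
  shows "\<phi> (T, p) (push (T, p) c) m h
    = \<phi> (three_beads m n g) (push (three_beads m n g) (plug m n g)) m (middle m g)"
proof -
  have ho: "h \<in> ord_maps m p" and gap: "T \<inter> {h 0<..<h m} = {}"
    using h by (auto simp: els_necklace_iff[OF T])
  have gm: "g \<in> ord_maps m n" using g by (simp add: els_horn_iff)
  have gv: "g k = c (h k)" if "k \<le> m" for k using that g by simp
  let ?r = "plug_dim m p h" and ?q = "plug_dim m n g"
  \<comment> \<open>All vertices outside the middle bead are joints, because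
    \<open>plug m p h\<close> has to cover \<open>T\<close>, whose elements may lie anywhere outside
    the open interval from \<open>h 0\<close> to \<open>h m\<close>.\<close>
  define B where "B = {..h 0} \<union> {h 0 + m..?r}"
  define U where "U = {0, g 0, g 0 + m, ?q}"
  have U_eq: "three_beads m n g = (U, ?q)" by (simp add: three_beads_def U_def)
  have B: "(B, ?r) \<in> ob Nec" by (auto simp: B_def ob_Nec_iff plug_dim_def)
  have U: "(U, ?q) \<in> ob Nec" using three_beads_ob[of m n g] by (simp add: U_eq)
  have Tp: "T \<subseteq> {..p}" using T by (simp add: ob_Nec_iff)
  note hle = ord_maps_le[OF ho] and hmono = ord_maps_mono[OF ho]
    and cle = ord_maps_le[OF c(1)] and cmono = ord_maps_mono[OF c(1)]
  have plug: "plug m p h \<in> hom Nec (B, ?r) (T, p)"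
    unfolding hom_Nec_iff
  proof (intro conjI plug_ord_maps ho plug_ends subsetI)
    fix u assume u: "u \<in> T"
    then consider "u \<le> h 0" | "h m \<le> u" "u \<le> p" using gap Tp by force
    then show "u \<in> plug m p h ` B"
    proof cases
      case 1
      then show ?thesis
        by (intro image_eqI[of _ _ u]) (auto simp: plug_def B_def plug_dim_def)
    next
      case 2
      have "h 0 \<le> h m" using hmono by simp
      with 2 have "plug m p h (h 0 + m + (u - h m)) = u"
        using plug_right[of "u - h m" p h m] by simp
      with 2 show ?thesis
        by (intro image_eqI[of _ _ "h 0 + m + (u - h m)"]) (auto simp: B_def plug_dim_def)
    qed
  qed
  \<comment> \<open>On the outer parts \<open>f\<close> is \<open>c\<close> in the coordinates of
    \<open>three_beads m n g\<close>, on the middle bead a shift; it is chosen so that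
    \<open>plug m n g\<close> after \<open>f\<close> is \<open>c\<close> after
    \<open>plug m p h\<close>. The subtraction of \<open>g m\<close> is not truncated, since
    \<open>c\<close> is at least \<open>c (h m) = g m\<close> there.\<close>
  define f where "f = (\<lambda>i\<in>{..?r}. if i \<le> h 0 then c i else if i \<le> h 0 + m then g 0 + (i - h 0)
     else g 0 + m + (c (i - (h 0 + m) + h m) - g m))"
  have f: "f \<in> hom Nec (B, ?r) (U, ?q)"
    unfolding hom_Nec_iff
  proof (intro conjI)
    have g0: "g 0 = c (h 0)" "g m = c (h m)" using gv by auto
    show "f \<in> ord_maps ?r ?q"
    proof (rule ord_mapsI)
      fix i assume i: "i \<le> ?r"
      show "f i \<le> ?q"
        using i cmono[of i "h 0"] hle[of 0] hle[of m] cle[of "i - (h 0 + m) + h m"] g0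
        by (auto simp: f_def plug_dim_def intro!: diff_le_mono)
    next
      fix i k assume ik: "i \<le> k" "k \<le> ?r"
      have "c i \<le> g 0" if "i \<le> h 0" using cmono[of i "h 0"] that hle[of 0] g0 by simp
      moreover have "c i \<le> c k" if "k \<le> h 0" using cmono[of i k] that ik hle[of 0] by simp
      moreover have "c (i - (h 0 + m) + h m) \<le> c (k - (h 0 + m) + h m)" if "h 0 + m \<le> i"
        using cmono that ik hle[of m] by (auto simp: plug_dim_def)
      ultimately show "f i \<le> f k"
        using ik by (auto simp: f_def intro: order_trans)
    qed (simp add: f_def)
    show f0: "f 0 = 0" using c by (simp add: f_def)
    \<comment> \<open>The end point falls into the last branch of \<open>f\<close> only if
      \<open>h m < p\<close>; otherwise it is \<open>h 0 + m\<close>, in the middle branch, or in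
      the first one when \<open>m = 0\<close>.\<close>
    show fr: "f ?r = ?q"
      using hle[of m] c g0 by (cases "h m = p"; cases m; auto simp: f_def plug_dim_def)
    have "f (h 0) = g 0" "f (h 0 + m) = g 0 + m" using g0 by (auto simp: f_def plug_dim_def)
    with f0 fr have "U = f ` {0, h 0, h 0 + m, ?r}" by (simp add: U_def)
    also have "\<dots> \<subseteq> f ` B" by (intro image_mono) (auto simp: B_def plug_dim_def)
    finally show "U \<subseteq> f ` B" .
  qed
  have mid: "middle m h \<in> els (necklace (B, ?r)) m"
    using middle_ord_maps[of m h p]
    by (intro iffD2[OF els_necklace_iff[OF B]]) (auto simp: B_def middle_def)
  have eq: "compose {..?r} (plug m n g) f = compose {..?r} c (plug m p h)"
  proof (rule ord_maps_eqI)
    show "compose {..?r} (plug m n g) f \<in> ord_maps ?r n"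
      using f ord_maps_compose plug_ord_maps[OF gm] by (auto simp: hom_Nec_iff)
    show "compose {..?r} c (plug m p h) \<in> ord_maps ?r n"
      using ord_maps_compose plug_ord_maps[OF ho] c by auto
    fix i assume i: "i \<le> ?r"
    have fi: "f i \<le> ?q" using f i ord_maps_le by (auto simp: hom_Nec_iff)
    consider "i \<le> h 0" | "h 0 < i" "i \<le> h 0 + m" | "h 0 + m < i" by linarith
    then have "plug m n g (f i) = c (plug m p h i)"
    proof cases
      case 1
      then have "c i \<le> g 0" using cmono[of i "h 0"] hle[of 0] gv[of 0] by simp
      then show ?thesis using 1 i fi by (simp add: plug_def f_def)
    next
      case 2
      define k where "k = i - h 0"
      then have k: "0 < k" "k \<le> m" "i = h 0 + k" using 2 by auto
      then have "f i = g 0 + k" "plug m p h i = h k" using i by (simp_all add: f_def plug_def)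
      then show ?thesis using fi k gv[of k] by (simp add: plug_def)
    next
      case 3
      let ?u = "i - (h 0 + m) + h m"
      have u: "g m \<le> c ?u"
        using cmono[of "h m" ?u] 3 i hle[of m] gv[of m] by (simp add: plug_dim_def)
      have "f i = g 0 + m + (c ?u - g m)" "plug m p h i = ?u"
        using 3 i by (simp_all add: plug_def f_def)
      then show ?thesis
        using u plug_right[of "c ?u - g m" n g m] cle[of ?u] i hle[of m]
        by (simp add: plug_dim_def diff_le_mono)
    qed
    with i show "compose {..?r} (plug m n g) f i = compose {..?r} c (plug m p h) i" by simp
  qed
  have fmid: "compose {..m} f (middle m h) = middle m g"
  proof -
    have "f (h 0 + i) = g 0 + i" if "i \<le> m" for i
      using that gv[of 0] by (auto simp: f_def plug_dim_def)
    then show ?thesis by (auto simp: compose_def middle_def fun_eq_iff)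
  qed
  have "\<phi> (T, p) (push (T, p) c) m h
      = \<phi> (B, ?r) (push (B, ?r) (compose {..?r} c (plug m p h))) m (middle m h)"
    using \<phi>_push_compose[OF B plug T \<chi> mid] plug_middle[OF ho] by simp
  also have "\<dots> = \<phi> (U, ?q) (push (U, ?q) (plug m n g)) m (middle m g)"
    using \<phi>_push_compose[OF B f U push_plug[OF g(2-4) j, unfolded U_eq] mid] unfolding eq fmid .
  finally show ?thesis by (simp add: U_eq)
qed

section \<open>Values at simplices constant at a base point\<close>

text \<open>Simplicial maps commute with degeneracies, and a constant simplex is a degeneracy of a
  vertex; at the end points of a necklace this yields a degenerate \<open>a\<close> or
  \<open>b\<close>.\<close>

lemma \<phi>_degenerate:
  assumes T: "(T, p) \<in> ob Nec" and \<chi>: "\<chi> \<in> els H (T, p)" and i: "i \<le> p"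
  shows "\<phi> (T, p) \<chi> m (\<lambda>k\<in>{..m}. i) = act X m 0 (\<lambda>k\<in>{..m}. 0) (\<phi> (T, p) \<chi> 0 (vert i))"
proof -
  have "compose {..m} (vert i) (\<lambda>k\<in>{..m}. 0) = (\<lambda>k\<in>{..m}. i)"
    by (auto simp: compose_def vert_def)
  then show ?thesis
    using sset_maps_act[OF \<phi>_els(1)[OF T \<chi>] const_ord_maps[of 0 0 m] vert_in_necklace'[OF T i]]
    by (simp add: act_necklace)
qed

text \<open>The necklace is truncated at \<open>h 0\<close>, since \<open>c\<close> is constant from there on.\<close>

lemma \<phi>_push_last:
  assumes T: "(T, p) \<in> ob Nec" and c: "c \<in> ord_maps p n" "c 0 = 0" "c p = n"
    and els: "\<And>l x. x \<in> els (necklace (T, p)) l \<Longrightarrow> compose {..l} c x \<in> els (horn n j) l"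
    and h: "h \<in> els (necklace (T, p)) m" and n: "c (h 0) = n"
  shows "\<phi> (T, p) (push (T, p) c) m h = act X m 0 (\<lambda>k\<in>{..m}. 0) b"
proof -
  have ho: "h \<in> ord_maps m p" using necklace_ord_maps[OF h] .
  note hle = ord_maps_le[OF ho] and cmono = ord_maps_mono[OF c(1)] and cle = ord_maps_le[OF c(1)]
  have T': "0 \<in> T" "p \<in> T" "T \<subseteq> {..p}" using T by (auto simp: ob_Nec_iff)
  \<comment> \<open>\<open>h 0\<close> becomes the last joint even if it is not in \<open>T\<close>,
    so that its value is \<open>b\<close>; the map \<open>f\<close> below collapses all later
    vertices onto it.\<close>
  define U where "U = insert (h 0) (T \<inter> {..h 0})"
  have U: "(U, h 0) \<in> ob Nec" using T' by (auto simp: U_def ob_Nec_iff)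
  define f where "f = (\<lambda>i\<in>{..p}. min i (h 0))"
  have f: "f \<in> hom Nec (T, p) (U, h 0)"
    unfolding hom_Nec_iff
  proof (intro conjI subsetI)
    show "f \<in> ord_maps p (h 0)" by (rule ord_mapsI) (auto simp: f_def)
    show fp: "f 0 = 0" "f p = h 0" using hle[of 0] by (auto simp: f_def)
    fix u assume "u \<in> U"
    then consider "u = h 0" | "u \<in> T" "u \<le> h 0" by (auto simp: U_def)
    then show "u \<in> f ` T"
    proof cases
      case 1
      then show ?thesis using fp T' by force
    next
      case 2
      then have "f u = u" using hle[of 0] by (simp add: f_def)
      then show ?thesis using 2 by force
    qed
  qed
  have "push (U, h 0) c \<in> els H (U, h 0)"
  proof (rule push_in_nec_of[OF U])
    fix l x assume "x \<in> els (necklace (U, h 0)) l"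
    then have x: "x \<in> ord_maps l (h 0)" "U \<inter> {x 0<..<x l} = {}" by (auto simp: els_necklace_iff[OF U])
    have "x l \<le> h 0" using ord_maps_le[OF x(1)] by simp
    then have "T \<inter> {x 0<..<x l} = {}" using x(2) by (auto simp: U_def)
    moreover have "x \<in> ord_maps l p"
    proof (rule ord_mapsI)
      fix i assume "i \<le> l"
      then show "x i \<le> p" using ord_maps_le[OF x(1), of i] hle[of 0] by simp
    qed (auto intro: ord_maps_mono[OF x(1)] ord_maps_extensional[OF x(1)])
    ultimately show "compose {..l} c x \<in> els (horn n j) l"
      by (intro els) (simp add: els_necklace_iff[OF T])
  qed (use c n in \<open>auto simp: act_horn\<close>)
  note \<chi> = this
  have "compose {..p} c f = c"
  proof (rule extensionalityI[of _ "{..p}"])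
    fix i assume "i \<in> {..p}"
    then show "compose {..p} c f i = c i"
      using n cmono[of "h 0" i] cle[of i] by (auto simp: f_def min_def)
  qed (use ord_maps_extensional[OF c(1)] in auto)
  then have "\<phi> (T, p) (push (T, p) c) m h = \<phi> (U, h 0) (push (U, h 0) c) m (compose {..m} f h)"
    using \<phi>_push_compose[OF T f U \<chi> h] by simp
  also have "compose {..m} f h = (\<lambda>k\<in>{..m}. h 0)"
    using hle ord_maps_mono[OF ho, of 0] by (auto simp: compose_def f_def)
  also have "\<phi> (U, h 0) (push (U, h 0) c) m (\<lambda>k\<in>{..m}. h 0) = act X m 0 (\<lambda>k\<in>{..m}. 0) b"
    using \<phi>_degenerate[OF U \<chi>, of "h 0" m] \<phi>_els(3)[OF U \<chi>] by simp
  finally show ?thesis .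
qed

text \<open>Dual to \<open>\<phi>_push_last\<close>: \<open>c\<close> vanishes up to
  \<open>h m\<close>, so this initial part of the necklace is collapsed to the first base
  point.\<close>

lemma \<phi>_push_first:
  assumes T: "(T, p) \<in> ob Nec" and c: "c \<in> ord_maps p n" "c 0 = 0" "c p = n"
    and els: "\<And>l x. x \<in> els (necklace (T, p)) l \<Longrightarrow> compose {..l} c x \<in> els (horn n j) l"
    and h: "h \<in> els (necklace (T, p)) m" and zero: "c (h m) = 0"
  shows "\<phi> (T, p) (push (T, p) c) m h = act X m 0 (\<lambda>k\<in>{..m}. 0) a"
proof -
  have ho: "h \<in> ord_maps m p" using necklace_ord_maps[OF h] .
  note hle = ord_maps_le[OF ho] and cmono = ord_maps_mono[OF c(1)] and cle = ord_maps_le[OF c(1)]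
  have T': "0 \<in> T" "p \<in> T" "T \<subseteq> {..p}" using T by (auto simp: ob_Nec_iff)
  let ?q = "p - h m"
  \<comment> \<open>Truncated subtraction performs the collapse, sending all of
    \<open>{..h m}\<close> to \<open>0\<close>.\<close>
  define f where "f = (\<lambda>i\<in>{..p}. i - h m)"
  define U where "U = f ` T"
  have U: "(U, ?q) \<in> ob Nec"
    unfolding ob_Nec_iff U_def
  proof (intro conjI)
    show "0 \<in> f ` T" using T' by (intro image_eqI[of _ _ 0]) (auto simp: f_def)
    show "?q \<in> f ` T" using T' by (intro image_eqI[of _ _ p]) (auto simp: f_def)
    show "f ` T \<subseteq> {..?q}" using T' by (auto simp: f_def)
  qed
  have f: "f \<in> hom Nec (T, p) (U, ?q)"
    unfolding hom_Nec_iff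
  proof (intro conjI)
    show "f \<in> ord_maps p ?q" by (rule ord_mapsI) (auto simp: f_def)
    show fp: "f 0 = 0" "f p = ?q" by (auto simp: f_def)
  qed (simp add: U_def)
  \<comment> \<open>\<open>d\<close> is \<open>c\<close> read from \<open>h m\<close> onwards;
    \<open>d\<close> after \<open>f\<close> is again \<open>c\<close> because \<open>c\<close> is
    zero before \<open>h m\<close>.\<close>
  define d where "d = (\<lambda>i\<in>{..?q}. c (i + h m))"
  have \<chi>: "push (U, ?q) d \<in> els H (U, ?q)"
  proof (rule push_in_nec_of[OF U])
    fix l x assume "x \<in> els (necklace (U, ?q)) l"
    then have x: "x \<in> ord_maps l ?q" "U \<inter> {x 0<..<x l} = {}" by (auto simp: els_necklace_iff[OF U])
    let ?y = "\<lambda>i\<in>{..l}. x i + h m"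
    have "T \<inter> {?y 0<..<?y l} = {}"
    proof -
      have False if "u \<in> T" "x 0 + h m < u" "u < x l + h m" for u
      proof -
        have "u - h m \<in> U" using that T' by (auto simp: U_def f_def)
        moreover have "u - h m \<in> {x 0<..<x l}" using that by auto
        ultimately show False using x(2) by blast
      qed
      then show ?thesis by auto
    qed
    moreover have "?y \<in> ord_maps l p"
    proof (rule ord_mapsI)
      fix i assume "i \<le> l"
      then show "?y i \<le> p" using ord_maps_le[OF x(1), of i] hle[of m] by simp
    qed (auto intro: ord_maps_mono[OF x(1)])
    ultimately have "compose {..l} c ?y \<in> els (horn n j) l"
      by (intro els) (simp add: els_necklace_iff[OF T])
    moreover have "compose {..l} c ?y = compose {..l} d x"
      using ord_maps_le[OF x(1)] by (auto simp: compose_def d_def)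
    ultimately show "compose {..l} d x \<in> els (horn n j) l" by simp
  qed (use c zero hle[of m] in \<open>auto simp: act_horn d_def\<close>)
  have "compose {..p} d f = c"
  proof (rule extensionalityI[of _ "{..p}"])
    fix i assume i: "i \<in> {..p}"
    then have fi: "f i = i - h m" "i - h m \<le> ?q" by (auto simp: f_def)
    show "compose {..p} d f i = c i"
    proof (cases "h m \<le> i")
      case True
      then show ?thesis using i fi by (simp add: d_def)
    next
      case False
      then show ?thesis using i fi zero cmono[of i "h m"] hle[of m] by (simp add: d_def)
    qed
  qed (use ord_maps_extensional[OF c(1)] in auto)
  then have "\<phi> (T, p) (push (T, p) c) m h = \<phi> (U, ?q) (push (U, ?q) d) m (compose {..m} f h)"
    using \<phi>_push_compose[OF T f U \<chi> h] by simp
  also have "compose {..m} f h = (\<lambda>k\<in>{..m}. 0)"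
    using hle ord_maps_mono[OF ho, of _ m] by (auto simp: compose_def f_def)
  also have "\<phi> (U, ?q) (push (U, ?q) d) m (\<lambda>k\<in>{..m}. 0) = act X m 0 (\<lambda>k\<in>{..m}. 0) a"
    using \<phi>_degenerate[OF U \<chi>, of 0 m] \<phi>_els(2)[OF U \<chi>] by simp
  finally show ?thesis .
qed

section \<open>The simplicial map on the horn\<close>

text \<open>On the horn, the first two cases are the simplices constant at \<open>n\<close> or
  \<open>0\<close>, to which \<open>push_plug\<close> does not apply; their values are prescribed as
  degenerate base points.\<close>

definition value_at :: "nat \<Rightarrow> (nat \<Rightarrow> nat) \<Rightarrow> 'a" where
  "value_at m g =
    (if g 0 = n then act X m 0 (\<lambda>k\<in>{..m}. 0) b
     else if g m = 0 then act X m 0 (\<lambda>k\<in>{..m}. 0) a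
     else \<phi> (three_beads m n g) (push (three_beads m n g) (plug m n g)) m (middle m g))"

text \<open>Independence of the presentation: the right-hand side sees only the simplex
  \<open>\<chi> m h\<close>. The three cases of \<open>value_at\<close> are settled by the three
  preceding comparisons.\<close>

lemma \<phi>_eq_value_at:
  assumes T: "(T, p) \<in> ob Nec" and \<chi>: "\<chi> \<in> els H (T, p)" and h: "h \<in> els (necklace (T, p)) m"
  shows "\<phi> (T, p) \<chi> m h = value_at m (\<chi> m h)"
proof -
  obtain c where c: "c \<in> ord_maps p n" "c 0 = 0" "c p = n" "\<chi> = push (T, p) c"
    "\<And>m h. h \<in> els (necklace (T, p)) m \<Longrightarrow> compose {..m} c h \<in> els (horn n j) m"
    using nec_of_horn_cases[OF T \<chi>] by metis
  define g where "g = compose {..m} c h"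
  have g: "\<chi> m h = g" "g \<in> els (horn n j) m" "c (h 0) = g 0" "c (h m) = g m"
    using h c(4) c(5)[OF h] by (simp_all add: g_def push_def)
  have "c (h 0) \<le> n"
    using ord_maps_le[OF c(1)] ord_maps_le[OF necklace_ord_maps[OF h]] by simp
  then consider "g 0 = n" | "g 0 < n" "g m = 0" | "g 0 < n" "0 < g m" using g by linarith
  then show ?thesis
  proof cases
    case 1
    then show ?thesis using \<phi>_push_last[OF T c(1-3,5) h] g by (simp add: value_at_def c(4)[symmetric])
  next
    case 2
    then show ?thesis using \<phi>_push_first[OF T c(1-3,5) h] g by (simp add: value_at_def c(4)[symmetric])
  next
    case 3
    then show ?thesis
      using \<phi>_push_nonconstant[OF T c(1-3) _ h g_def g(2)] g(1) \<chi>
      by (simp add: value_at_def c(4)[symmetric])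
  qed
qed

text \<open>Every simplex of the horn occurs as \<open>\<chi> m h\<close>, and there \<theta> agrees
  with the simplicial map \<open>\<phi> (T, p) \<chi>\<close>; so \<theta> inherits compatibility
  with the simplicial operators from one presentation at a time.\<close>

lemma horn_map:
  "\<exists>\<theta>\<in>sset_maps (horn n j) X. \<theta> 0 (vert 0) = a \<and> \<theta> 0 (vert n) = b \<and>
    (\<forall>T p \<chi> m h. (T, p) \<in> ob Nec \<longrightarrow> \<chi> \<in> els H (T, p) \<longrightarrow> h \<in> els (necklace (T, p)) m \<longrightarrow>
      \<phi> (T, p) \<chi> m h = \<theta> m (\<chi> m h))"
proof -
  define \<theta> where "\<theta> = (\<lambda>m. \<lambda>g\<in>els (horn n j) m. value_at m g)"
  have key: "\<phi> (T, p) \<chi> m h = \<theta> m (\<chi> m h)"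
    if "(T, p) \<in> ob Nec" "\<chi> \<in> els H (T, p)" "h \<in> els (necklace (T, p)) m" for T p \<chi> m h
    using that \<phi>_eq_value_at[OF that] sset_maps_els[of \<chi> "necklace (T, p)" "horn n j" h m]
    by (simp add: \<theta>_def els_nec_of_iff)
  have pres: "\<exists>T p \<chi> h. (T, p) \<in> ob Nec \<and> \<chi> \<in> els H (T, p) \<and> h \<in> els (necklace (T, p)) m \<and> \<chi> m h = g"
    if g: "g \<in> els (horn n j) m" for m g
  proof -
    obtain T p c h where "(T, p) \<in> ob Nec" "push (T, p) c \<in> els H (T, p)"
      "h \<in> els (necklace (T, p)) m" "compose {..m} c h = g"
      using horn_simplex_presentation[OF g j] by metis
    then show ?thesis by (intro exI[of _ T] exI[of _ p] exI[of _ "push (T, p) c"] exI[of _ h])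
        (simp add: push_def)
  qed
  have "\<theta> \<in> sset_maps (horn n j) X"
  proof (rule sset_mapsI)
    fix m g assume "g \<in> els (horn n j) m"
    then obtain T p \<chi> h where "(T, p) \<in> ob Nec" "\<chi> \<in> els H (T, p)"
      "h \<in> els (necklace (T, p)) m" "\<chi> m h = g" using pres by metis
    then show "\<theta> m g \<in> els X m" using key \<phi>_els(1) sset_maps_els by metis
  next
    fix l m f g assume f: "f \<in> ord_maps l m" and "g \<in> els (horn n j) m"
    then obtain T p \<chi> h where p: "(T, p) \<in> ob Nec" "\<chi> \<in> els H (T, p)"
      "h \<in> els (necklace (T, p)) m" "\<chi> m h = g" using pres by metis
    \<comment> \<open>The same necklace \<chi> also presents the image of \<open>g\<close> under the
      operator \<open>f\<close>, at the simplex \<open>h\<close> composed with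
      \<open>f\<close>.\<close>
    let ?hf = "compose {..l} h f"
    have hf: "?hf \<in> els (necklace (T, p)) l" using necklace_compose[OF p(3) f] .
    have "\<chi> l ?hf = act (horn n j) l m f g"
      using sset_maps_act[of \<chi> "necklace (T, p)" "horn n j" f l m h] f p
      by (simp add: els_nec_of_iff act_necklace)
    moreover have "\<phi> (T, p) \<chi> l ?hf = act X l m f (\<phi> (T, p) \<chi> m h)"
      using sset_maps_act[OF \<phi>_els(1)[OF p(1,2)] f p(3)] by (simp add: act_necklace)
    ultimately show "\<theta> l (act (horn n j) l m f g) = act X l m f (\<theta> m g)"
      using key[OF p(1,2) hf] key[OF p(1,2,3)] p(4) by simp
  qed (simp add: \<theta>_def)
  moreover have "\<theta> 0 (vert 0) = a \<and> \<theta> 0 (vert n) = b"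
  proof -
    \<comment> \<open>Any simplex of the horn would do: it only supplies a necklace \<chi> on which
      the base points are read off.\<close>
    have "vert 0 \<in> els (horn n j) 0"
      using j vert_ord_maps[of 0 n] by (auto simp: els_horn_iff vert_def)
    then obtain T p \<chi> h where T: "(T, p) \<in> ob Nec" and \<chi>: "\<chi> \<in> els H (T, p)"
      using pres by metis
    have "vert 0 \<in> els (necklace (T, p)) 0" "vert p \<in> els (necklace (T, p)) 0"
      using vert_in_necklace'[OF T] by auto
    then show ?thesis
      using key[OF T \<chi>] \<phi>_els(2,3)[OF T \<chi>] \<chi> by (metis els_nec_of_iff)
  qed
  ultimately show ?thesis using key by (intro bexI[of _ \<theta>]) auto
qed

end


section \<open>Simplicial maps and transformations of necklace presheaves\<close>

text \<open>Postcomposition with \<theta>, restricted at the levels of necklaces, elements and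
  simplices so that it is extensional as \<open>nat_trans\<close> demands.\<close>

definition nec_map ::
  "'a sset \<Rightarrow> 'a \<Rightarrow> 'a \<Rightarrow> (nat \<Rightarrow> 'a \<Rightarrow> 'b)
    \<Rightarrow> nat set \<times> nat \<Rightarrow> (nat \<Rightarrow> (nat \<Rightarrow> nat) \<Rightarrow> 'a) \<Rightarrow> nat \<Rightarrow> (nat \<Rightarrow> nat) \<Rightarrow> 'b" where
  "nec_map K a b \<theta> = (\<lambda>T\<in>ob Nec. \<lambda>\<chi>\<in>els (nec_of K a b) T.
     \<lambda>m. \<lambda>h\<in>els (necklace T) m. \<theta> m (\<chi> m h))"

lemma nec_map_nat_trans:
  assumes K: "simplicial_set K" and \<theta>: "\<theta> \<in> sset_maps K L"
  shows "nec_map K a b \<theta> \<in> nat_trans Nec (nec_of K a b) (nec_of L (\<theta> 0 a) (\<theta> 0 b))"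
proof -
  have els: "nec_map K a b \<theta> (T, p) \<chi> \<in> els (nec_of L (\<theta> 0 a) (\<theta> 0 b)) (T, p)"
    if T: "(T, p) \<in> ob Nec" and \<chi>: "\<chi> \<in> els (nec_of K a b) (T, p)" for T p \<chi>
  proof -
    have \<chi>': "\<chi> \<in> sset_maps (necklace (T, p)) K" using \<chi> by (simp add: els_nec_of_iff)
    show ?thesis
      unfolding els_nec_of_iff
    proof (intro conjI sset_mapsI)
      fix m h assume "h \<in> els (necklace (T, p)) m"
      then show "nec_map K a b \<theta> (T, p) \<chi> m h \<in> els L m"
        using T \<chi> sset_maps_els[OF \<theta> sset_maps_els[OF \<chi>']] by (simp add: nec_map_def)
    next
      fix l m f h assume f: "f \<in> ord_maps l m" and h: "h \<in> els (necklace (T, p)) m"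
      then show "nec_map K a b \<theta> (T, p) \<chi> l (act (necklace (T, p)) l m f h) =
          act L l m f (nec_map K a b \<theta> (T, p) \<chi> m h)"
        using T \<chi> necklace_compose[OF h f] sset_maps_act[OF \<chi>' f h]
          sset_maps_act[OF \<theta> f sset_maps_els[OF \<chi>' h]]
        by (simp add: nec_map_def act_necklace)
    next
      show "nec_map K a b \<theta> (T, p) \<chi> 0 (vert 0) = \<theta> 0 a"
        "nec_map K a b \<theta> (T, p) \<chi> 0 (vert p) = \<theta> 0 b"
        using T \<chi> vert_in_necklace'[OF T] by (auto simp: nec_map_def els_nec_of_iff)
    qed (use T \<chi> in \<open>simp add: nec_map_def\<close>)
  qed
  have nat: "nec_map K a b \<theta> (T, p) (act (nec_of K a b) (T, p) (U, q) f \<chi>) =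
      act (nec_of L (\<theta> 0 a) (\<theta> 0 b)) (T, p) (U, q) f (nec_map K a b \<theta> (U, q) \<chi>)"
    if T: "(T, p) \<in> ob Nec" and U: "(U, q) \<in> ob Nec" and f: "f \<in> hom Nec (T, p) (U, q)"
      and \<chi>: "\<chi> \<in> els (nec_of K a b) (U, q)" for T p U q f \<chi>
  proof -
    have "act (nec_of K a b) (T, p) (U, q) f \<chi> \<in> els (nec_of K a b) (T, p)"
      using presheaf_nec_of[OF K, of a b] T U f \<chi> unfolding presheaf_def by blast
    then show ?thesis
      using T U \<chi> necklace_map[OF T f U] by (auto simp: nec_map_def act_nec_of fun_eq_iff)
  qed
  show ?thesis
    unfolding nat_trans_def
  proof (intro CollectI conjI ballI)
    have "nec_map K a b \<theta> (T, p) \<in> els (nec_of K a b) (T, p)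
        \<rightarrow>\<^sub>E els (nec_of L (\<theta> 0 a) (\<theta> 0 b)) (T, p)" if "(T, p) \<in> ob Nec" for T p
      using els[OF that] that by (auto simp: PiE_iff nec_map_def)
    then show "nec_map K a b \<theta> \<in> (\<Pi>\<^sub>E T\<in>ob Nec. els (nec_of K a b) T
        \<rightarrow>\<^sub>E els (nec_of L (\<theta> 0 a) (\<theta> 0 b)) T)"
      by (auto simp: PiE_iff nec_map_def)
  next
    fix T U f \<chi>
    assume "T \<in> ob Nec" "U \<in> ob Nec" "f \<in> hom Nec T U" "\<chi> \<in> els (nec_of K a b) U"
    then show "nec_map K a b \<theta> T (act (nec_of K a b) T U f \<chi>) =
      act (nec_of L (\<theta> 0 a) (\<theta> 0 b)) T U f (nec_map K a b \<theta> U \<chi>)"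
      using nat by (cases T; cases U) blast
  qed
qed

section \<open>Fillers give extensions of transformations\<close>

lemma nec_of_horn_subset:
  "\<chi> \<in> els (nec_of (horn n j) a b) T \<Longrightarrow> \<chi> \<in> els (nec_of (std_simplex n) a b) T"
  by (cases T) (auto simp: els_nec_of_iff intro: sset_maps_horn_std_simplex)

lemma vert_in_horn:
  assumes "0 < j" "j < n"
  shows "vert 0 \<in> els (horn n j) 0" "vert n \<in> els (horn n j) 0"
  using assms vert_ord_maps[of 0 n] vert_ord_maps[of n n]
  by (auto simp: els_horn_iff vert_def intro: exI[of _ n] exI[of _ 0])

lemma quasi_category_imp_lifts:
  assumes X: "simplicial_set X" and q: "quasi_category X"
  shows "lifts_inner_horns (nec_of X a b)"
  unfolding lifts_inner_horns_def
proof (intro allI impI ballI)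
  fix n j \<phi>
  assume j: "0 < j \<and> j < n"
    and \<phi>: "\<phi> \<in> nat_trans Nec (nec_of (horn n j) (vert 0) (vert n)) (nec_of X a b)"
  then interpret horn_transformation X n j a b \<phi>
    using X by (simp add: horn_transformation_def)
  obtain \<theta> where \<theta>: "\<theta> \<in> sset_maps (horn n j) X" and
    ends_key: "\<theta> 0 (vert 0) = a \<and> \<theta> 0 (vert n) = b \<and>
      (\<forall>T p \<chi> m h. (T, p) \<in> ob Nec \<longrightarrow> \<chi> \<in> els H (T, p) \<longrightarrow> h \<in> els (necklace (T, p)) m \<longrightarrow>
        \<phi> (T, p) \<chi> m h = \<theta> m (\<chi> m h))"
    using horn_map by (rule bexE)
  have key: "\<phi> (T, p) \<chi> m h = \<theta> m (\<chi> m h)"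
    if "(T, p) \<in> ob Nec" "\<chi> \<in> els H (T, p)" "h \<in> els (necklace (T, p)) m" for T p \<chi> m h
    using ends_key that by blast
  obtain \<psi> where \<psi>: "\<psi> \<in> sset_maps (std_simplex n) X"
    and ext_all: "\<forall>m. \<forall>x\<in>els (horn n j) m. \<psi> m x = \<theta> m x"
    using q[unfolded quasi_category_def, rule_format, OF conjI[OF j] \<theta>] by (rule bexE)
  have ext: "\<psi> m x = \<theta> m x" if "x \<in> els (horn n j) m" for m x
    using ext_all that by blast
  \<comment> \<open>The filler keeps the base points because the vertices \<open>0\<close> and
    \<open>n\<close> already lie in the horn.\<close>
  have ends: "\<psi> 0 (vert 0) = a" "\<psi> 0 (vert n) = b"
    using ext[of "vert 0" 0] ext[of "vert n" 0] vert_in_horn[of j n] j conjunct1[OF ends_key]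
      conjunct1[OF conjunct2[OF ends_key]] by auto
  let ?\<Psi> = "nec_map (std_simplex n) (vert 0) (vert n) \<psi>"
  show "\<exists>\<Psi>\<in>nat_trans Nec (nec_of (std_simplex n) (vert 0) (vert n)) (nec_of X a b).
    \<forall>T\<in>ob Nec. \<forall>x\<in>els (nec_of (horn n j) (vert 0) (vert n)) T. \<Psi> T x = \<phi> T x"
  proof (intro bexI[of _ ?\<Psi>] ballI)
    show "?\<Psi> \<in> nat_trans Nec (nec_of (std_simplex n) (vert 0) (vert n)) (nec_of X a b)"
      using nec_map_nat_trans[OF simplicial_set_std_simplex \<psi>, of "vert 0" "vert n"] ends by simp
  next
    fix T \<chi> assume T: "T \<in> ob Nec" and \<chi>: "\<chi> \<in> els H T"
    obtain U p where Tp: "T = (U, p)" by (cases T)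
    show "?\<Psi> T \<chi> = \<phi> T \<chi>"
    proof (intro HOL.ext)
      fix m h
      show "?\<Psi> T \<chi> m h = \<phi> T \<chi> m h"
      proof (cases "h \<in> els (necklace T) m")
        case True
        have "\<chi> m h \<in> els (horn n j) m"
          using \<chi> True sset_maps_els[of \<chi> "necklace T" "horn n j" h m]
          by (simp add: Tp els_nec_of_iff)
        then show ?thesis
          using T \<chi> True nec_of_horn_subset[OF \<chi>] key[of U p \<chi> h m] ext
          by (simp add: nec_map_def Tp)
      next
        case False
        then show ?thesis
          using T \<chi> nec_of_horn_subset[OF \<chi>] sset_maps_extensional[OF \<phi>_els(1), of U p \<chi> m]
          by (simp add: nec_map_def Tp extensional_def)
      qed
    qed
  qed
qed

section \<open>Extensions of transformations give fillers\<close>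

text \<open>The one-bead necklace is the whole simplex, so an element of a necklace presheaf at
  \<open>({0, n}, n)\<close> is a map out of \<open>std_simplex n\<close>.\<close>

lemma els_necklace_simplex: "els (necklace ({0, n}, n)) m = ord_maps m n"
proof -
  have T: "({0, n}, n) \<in> ob Nec" by (simp add: ob_Nec_iff)
  have "{0, n} \<inter> {g 0<..<g m} = {}" if "g \<in> ord_maps m n" for g
    using ord_maps_le[OF that, of m] by auto
  then show ?thesis by (auto simp: els_necklace_iff[OF T])
qed

text \<open>A Yoneda argument: the value \<psi> of the extension at the identity necklace is the
  filler. To see that it restricts to \<theta>, a simplex of the horn is presented as
  \<open>c\<close> after \<open>h\<close>, and naturality along \<open>c\<close> carries \<psi> to
  the value of the extension at a necklace inside the horn.\<close>

lemma lifts_imp_quasi_category: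
  assumes X: "simplicial_set X" and q: "quasi_category_in_Set X"
  shows "quasi_category X"
  unfolding quasi_category_def
proof (intro allI impI ballI)
  fix n j \<theta> assume j: "0 < j \<and> j < n" and \<theta>: "\<theta> \<in> sset_maps (horn n j) X"
  let ?a = "\<theta> 0 (vert 0)" and ?b = "\<theta> 0 (vert n)"
  let ?H = "nec_of (horn n j) (vert 0) (vert n)" and ?S = "nec_of (std_simplex n) (vert 0) (vert n)"
  let ?N = "({0, n}, n)" and ?id = "\<lambda>i\<in>{..n}. i"
  let ?\<phi> = "nec_map (horn n j) (vert 0) (vert n) \<theta>"
  have ab: "?a \<in> els X 0" "?b \<in> els X 0"
    using sset_maps_els[OF \<theta>] vert_in_horn[of j n] j by auto
  obtain \<Psi> where \<Psi>: "\<Psi> \<in> nat_trans Nec ?S (nec_of X ?a ?b)"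
    and ext_all: "\<forall>T\<in>ob Nec. \<forall>\<chi>\<in>els ?H T. \<Psi> T \<chi> = ?\<phi> T \<chi>"
    using bspec[OF bspec[OF q[unfolded quasi_category_in_Set_def] ab(1)] ab(2),
      unfolded lifts_inner_horns_def, rule_format, OF j nec_map_nat_trans[OF simplicial_set_horn \<theta>]] by (rule bexE)
  have ext: "\<Psi> T \<chi> = ?\<phi> T \<chi>" if "T \<in> ob Nec" "\<chi> \<in> els ?H T" for T \<chi>
    using ext_all that by blast
  have N: "?N \<in> ob Nec" by (simp add: ob_Nec_iff)
  have I: "push ?N ?id \<in> els ?S ?N"
    by (rule push_in_nec_of[OF N])
      (auto simp: act_std_simplex els_std_simplex els_necklace_simplex ord_maps_compose_id)
  define \<psi> where "\<psi> = \<Psi> ?N (push ?N ?id)"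
  have "\<psi> \<in> els (nec_of X ?a ?b) ?N"
    using \<Psi> N I unfolding nat_trans_def \<psi>_def by blast
  then have \<psi>N: "\<psi> \<in> sset_maps (necklace ?N) X" by (simp add: els_nec_of_iff)
  show "\<exists>\<psi>\<in>sset_maps (std_simplex n) X. \<forall>m. \<forall>x\<in>els (horn n j) m. \<psi> m x = \<theta> m x"
  proof (intro bexI[of _ \<psi>] allI ballI)
    show "\<psi> \<in> sset_maps (std_simplex n) X"
      using \<psi>N by (simp add: nat_trans_def els_necklace_simplex act_necklace els_std_simplex
          act_std_simplex)
  next
    fix m g assume g: "g \<in> els (horn n j) m"
    obtain T p c h where T: "(T, p) \<in> ob Nec" and c: "c \<in> ord_maps p n" "c 0 = 0" "c p = n"
      and \<chi>: "push (T, p) c \<in> els ?H (T, p)"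
      and h: "h \<in> els (necklace (T, p)) m" "compose {..m} c h = g"
      using horn_simplex_presentation[OF g conjunct1[OF j] conjunct2[OF j]] .
    \<comment> \<open>As \<open>c\<close> preserves end points, it is itself a morphism to the
      one-bead necklace, and \<open>push (T, p) c\<close> is the pullback of the identity along
      it.\<close>
    have f: "c \<in> hom Nec (T, p) ?N"
      using c T by (force simp: hom_Nec_iff ob_Nec_iff)
    have "push (T, p) (compose {..p} ?id c) = push (T, p) c"
      using c by (simp add: ord_maps_compose_id)
    moreover have "\<Psi> (T, p) (act ?S (T, p) ?N c (push ?N ?id)) = act (nec_of X ?a ?b) (T, p) ?N c \<psi>"
      using \<Psi> T N f I unfolding nat_trans_def \<psi>_def by blast
    ultimately have "\<Psi> (T, p) (push (T, p) c) = act (nec_of X ?a ?b) (T, p) ?N c \<psi>"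
      by (simp only: act_push[OF T f N])
    then have "\<psi> m g = \<Psi> (T, p) (push (T, p) c) m h"
      using h by (simp add: act_nec_of)
    also have "\<dots> = \<theta> m g"
      using ext[OF T \<chi>] T \<chi> h by (simp add: nec_map_def push_def)
    finally show "\<psi> m g = \<theta> m g" .
  qed
qed

theorem proposition5p8:
  fixes X :: "'a sset"
  assumes "simplicial_set X"
  shows "quasi_category X \<longleftrightarrow> quasi_category_in_Set X"
  using quasi_category_imp_lifts[OF assms] lifts_imp_quasi_category[OF assms]
  unfolding quasi_category_in_Set_def by blast

end
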